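(* Let $n\in\mathbb N$, $n\le N$, and let $P_N$ be a monic polynomial of degree $N$ that is quasi-orthogonal with respect to $w$ on $\Delta$, in the sense that $$\int_\Delta x^jP_N(x)w(x)\,dx=0,\quad j=0,1,\dots,n-1,\qquad m_n:=\int_\Delta x^nP_N(x)w(x)\,dx\ne0.$$ Then for the electrostatic partner $S_N=\mathfrak D_w[P_N]$, as $z\to\infty$, $$S_N(z)=m_n\,z^{N-n}\left[(N+n+1)\,z^{\deg(A)-2}\left(1+O(1/z)\right)+\kappa\,z^{\deg(B)-1}\left(1+O(1/z)\right)\right],$$ where $\kappa$ is the leading coefficient of $B$. In particular, $\deg(S_N)\le N-n+\sigma$, and it can be strictly less only if $\deg(A)=\deg(B)+1$ and $\kappa=-(N+n+1)$. Moreover, if $n\ge\sigma+1$ then $H_N\equiv0$, and if $n\ge\sigma+2$ then additionally $U_N$ (of degree $\le N-1$) is quasi-orthogonal: $$\int_\Delta x^jU_N(x)w(x)\,dx=0,\qquad j=0,\dots,n-\sigma-2.$$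
   Context: Semiclassical weight. $A$ is a monic polynomial with set of zeros $\mathbb A\subset\mathbb C$ (possibly empty), and $B$ is a polynomial (not assumed coprime to $A$; if $B\equiv0$, the terms involving $\kappa$ and $\deg(B)$ are absent). $\Delta=\Gamma_1\cup\dots\cup\Gamma_k$, where each $\Gamma_j$ is an oriented Jordan piecewise analytic arc joining a pair of points of $\mathbb A\cup\{\infty\}$ and containing no other point of $\mathbb A$ in its interior; the interiors of the $\Gamma_j$ are pairwise disjoint. Up to a normalization constant, define the (multivalued) analytic functions $$w(z)=\exp\left(\int^z\frac{B(t)}{A(t)}\,dt\right),\qquad v(z)=A(z)w(z),$$ so that $w'/w=B/A$. The weight on $\Delta$, denoted by the same letter $w$, coincides on each $\Gamma_j$, up to a non-zero multiplicative constant, with the left boundary value $w_+$. It is assumed that $\int_\Delta|z|^m|w(z)||dz|<+\infty$ for $m=0,1,2,\dots$; as a consequence, $z^mv(z)=0$ (in the limit sense) at every endpoint of a subarc of $\Delta$, for all $m=0,1,2,\dots$. Put $\sigma=\max\{\deg(A)-2,\deg(B)-1\}$; it is assumed that $\sigma\ge0$. Cauchy transform: $\mathfrak C_w[f](z)=\int_\Delta\frac{f(t)w(t)}{t-z}\,dt$. The electrostatic partner of $P_N$ is the function $$S_N=\mathfrak D_w[P_N]:=\det\begin{pmatrix}P_N&\mathfrak C_w[P_N]\\ AP_N'&A(\mathfrak C_w[P_N])'-B\,\mathfrak C_w[P_N]\end{pmatrix},$$ which is a polynomial. Definition of $U_N$ and $H_N$: let $E$ be the polynomial part of the Laurent expansion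 of $AP_N'/P_N$ at $\infty$, i.e. $AP_N'/P_N=E+O(1/z)$. Then $U_N:=AP_N'-EP_N$, a polynomial of degree $\le N-1$, and $$H_N(z):=\int_\Delta\frac{A(z)-A(x)+A'(x)(x-z)}{(x-z)^2}P_N(x)w(x)\,dx+\int_\Delta\frac{(E+B)(x)-(E+B)(z)}{x-z}\,P_N(x)w(x)\,dx,$$ a polynomial of degree $\le\sigma$. *)

theory Defs
  imports "HOL-Complex_Analysis.Complex_Analysis" "HOL-Library.Landau_Symbols"
    "HOL-Computational_Algebra.Polynomial"
begin

section \<open>Piecewise analytic arcs on the Riemann sphere\<close>

text \<open>
  An oriented arc is given by a parametrization over the open interval \<open>{0<..<1}\<close>, so that either
  end may lie at infinity. The values at \<open>0\<close> and \<open>1\<close> are irrelevant everywhere below; the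
  endpoints are the limits there.
\<close>

definition arc_interior :: "(real \<Rightarrow> complex) \<Rightarrow> complex set" where
  "arc_interior \<gamma> = \<gamma> ` {0<..<1}"

text \<open>The closure adds exactly the finite endpoints.\<close>

definition arc_trace :: "(real \<Rightarrow> complex) \<Rightarrow> complex set" where
  "arc_trace \<gamma> = closure (arc_interior \<gamma>)"

text \<open>\<open>\<gamma>\<close> is near \<open>t\<close> a regular (non-zero derivative) real-analytic parametrization, expressed
  through a holomorphic extension to a complex neighbourhood of \<open>t\<close>.\<close>

definition regular_analytic_at :: "(real \<Rightarrow> complex) \<Rightarrow> real \<Rightarrow> bool" where
  "regular_analytic_at \<gamma> t \<longleftrightarrow>
     (\<exists>g. g analytic_on {of_real t} \<and> deriv g (of_real t) \<noteq> 0 \<and>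
          (\<forall>\<^sub>F s in nhds t. \<gamma> s = g (of_real s)))"

definition ends_in :: "(real \<Rightarrow> complex) \<Rightarrow> real filter \<Rightarrow> complex set \<Rightarrow> bool" where
  "ends_in \<gamma> F Z \<longleftrightarrow> (\<exists>a\<in>Z. (\<gamma> \<longlongrightarrow> a) F) \<or> filterlim \<gamma> at_infinity F"

text \<open>
  A Jordan arc joining two points of \<open>Z \<union> {\<infinity>}\<close>. Both ends may lie at infinity (the real line, for
  the Hermite weight), but the arc is not a loop based at a finite point.
\<close>

definition piecewise_analytic_jordan_arc :: "complex set \<Rightarrow> (real \<Rightarrow> complex) \<Rightarrow> bool" where
  "piecewise_analytic_jordan_arc Z \<gamma> \<longleftrightarrow>
     continuous_on {0<..<1} \<gamma> \<and> inj_on \<gamma> {0<..<1} \<and>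
     (\<exists>S. finite S \<and> (\<forall>t\<in>{0<..<1} - S. regular_analytic_at \<gamma> t)) \<and>
     ends_in \<gamma> (at_right 0) Z \<and> ends_in \<gamma> (at_left 1) Z \<and>
     \<not> (\<exists>a. (\<gamma> \<longlongrightarrow> a) (at_right 0) \<and> (\<gamma> \<longlongrightarrow> a) (at_left 1)) \<and>
     arc_interior \<gamma> \<inter> Z = {}"

section \<open>Semiclassical weights\<close>

definition poly_zeros :: "complex poly \<Rightarrow> complex set" where
  "poly_zeros A = {z. poly A z = 0}"

text \<open>\<open>L\<close> contains a neighbourhood of every smooth point of the arc, intersected with the left-hand
  side of the arc.\<close>

definition left_neighbourhood :: "(real \<Rightarrow> complex) \<Rightarrow> complex set \<Rightarrow> bool" where
  "left_neighbourhood \<gamma> L \<longleftrightarrow>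
     open L \<and> connected L \<and> L \<inter> arc_interior \<gamma> = {} \<and>
     (\<forall>t\<in>{0<..<1}. regular_analytic_at \<gamma> t \<longrightarrow>
        (\<forall>\<^sub>F (s, e) in nhds t \<times>\<^sub>F at_right 0.
           \<gamma> s + \<i> * of_real e * vector_derivative \<gamma> (at s) \<in> L))"

text \<open>
  On the interior of \<open>\<gamma>\<close>, \<open>w\<close> is a non-zero multiple of the left boundary value of a single-valued
  branch \<open>exp F\<close> of \<open>exp (\<integral> B/A)\<close>. The limit is also required at the corners of the arc, so
  the branch does not change along the arc.
\<close>

definition left_boundary_weight ::
    "complex poly \<Rightarrow> complex poly \<Rightarrow> (real \<Rightarrow> complex) \<Rightarrow> (complex \<Rightarrow> complex) \<Rightarrow> bool" where
  "left_boundary_weight A B \<gamma> w \<longleftrightarrow>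
     (\<exists>L F c. left_neighbourhood \<gamma> L \<and> L \<inter> poly_zeros A = {} \<and> c \<noteq> 0 \<and>
        (\<forall>z\<in>L. (F has_field_derivative poly B z / poly A z) (at z)) \<and>
        (\<forall>t\<in>{0<..<1}. ((\<lambda>z. c * exp (F z)) \<longlongrightarrow> w (\<gamma> t)) (at (\<gamma> t) within L)))"

text \<open>The convention for \<open>B = 0\<close> is that the term with \<open>degree B\<close> is absent.\<close>

definition semiclassical_sigma :: "complex poly \<Rightarrow> complex poly \<Rightarrow> int" where
  "semiclassical_sigma A B =
     (if B = 0 then int (degree A) - 2 else max (int (degree A) - 2) (int (degree B) - 1))"

definition semiclassical_weight ::
    "complex poly \<Rightarrow> complex poly \<Rightarrow> nat \<Rightarrow> (nat \<Rightarrow> real \<Rightarrow> complex) \<Rightarrow> (complex \<Rightarrow> complex) \<Rightarrow> bool"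
where
  "semiclassical_weight A B k \<Gamma> w \<longleftrightarrow>
     lead_coeff A = 1 \<and>
     (\<forall>j<k. piecewise_analytic_jordan_arc (poly_zeros A) (\<Gamma> j)) \<and>
     disjoint_family_on (\<lambda>j. arc_interior (\<Gamma> j)) {..<k} \<and>
     (\<forall>j<k. left_boundary_weight A B (\<Gamma> j) w) \<and>
     (\<forall>j<k. \<forall>m. (\<lambda>t. norm (\<Gamma> j t) ^ m * norm (w (\<Gamma> j t)) * norm (vector_derivative (\<Gamma> j) (at t)))
                  integrable_on {0<..<1}) \<and>
     semiclassical_sigma A B \<ge> 0"

definition Delta :: "nat \<Rightarrow> (nat \<Rightarrow> real \<Rightarrow> complex) \<Rightarrow> complex set" where
  "Delta k \<Gamma> = (\<Union>j<k. arc_trace (\<Gamma> j))"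

definition Delta_integral ::
    "nat \<Rightarrow> (nat \<Rightarrow> real \<Rightarrow> complex) \<Rightarrow> (complex \<Rightarrow> complex) \<Rightarrow> complex" where
  "Delta_integral k \<Gamma> f = (\<Sum>j<k. contour_integral (\<Gamma> j) f)"

section \<open>Cauchy transform, electrostatic partner, and the polynomials \<open>U\<close> and \<open>H\<close>\<close>

definition cauchy_transform ::
    "nat \<Rightarrow> (nat \<Rightarrow> real \<Rightarrow> complex) \<Rightarrow> (complex \<Rightarrow> complex) \<Rightarrow> (complex \<Rightarrow> complex) \<Rightarrow> complex \<Rightarrow> complex"
where
  "cauchy_transform k \<Gamma> w f z = Delta_integral k \<Gamma> (\<lambda>t. f t * w t / (t - z))"

text \<open>Meaningful for \<open>z \<notin> Delta k \<Gamma>\<close> only.\<close>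

definition electrostatic_partner ::
    "complex poly \<Rightarrow> complex poly \<Rightarrow> nat \<Rightarrow> (nat \<Rightarrow> real \<Rightarrow> complex) \<Rightarrow> (complex \<Rightarrow> complex)
      \<Rightarrow> (complex \<Rightarrow> complex) \<Rightarrow> complex \<Rightarrow> complex" where
  "electrostatic_partner A B k \<Gamma> w f z =
     (let C = cauchy_transform k \<Gamma> w f in
      det (vector [vector [f z, C z],
                   vector [poly A z * deriv f z, poly A z * deriv C z - poly B z * C z]]
           :: complex ^ 2 ^ 2))"

definition polynomial_part_at_infinity :: "(complex \<Rightarrow> complex) \<Rightarrow> complex poly" where
  "polynomial_part_at_infinity f = (THE E. (\<lambda>z. f z - poly E z) \<in> O[at_infinity](\<lambda>z. 1 / z))"

definition E_poly :: "complex poly \<Rightarrow> complex poly \<Rightarrow> complex poly" where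
  "E_poly A P = polynomial_part_at_infinity (\<lambda>z. poly A z * poly (pderiv P) z / poly P z)"

definition U_poly :: "complex poly \<Rightarrow> complex poly \<Rightarrow> complex poly" where
  "U_poly A P = A * pderiv P - E_poly A P * P"

text \<open>For \<open>z\<close> on an arc, the integrands below are off (\<open>0 / 0 = 0\<close>) at the single point \<open>x = z\<close>
  only, which does not affect the integrals.\<close>

definition H_fun ::
    "complex poly \<Rightarrow> complex poly \<Rightarrow> nat \<Rightarrow> (nat \<Rightarrow> real \<Rightarrow> complex) \<Rightarrow> (complex \<Rightarrow> complex)
      \<Rightarrow> complex poly \<Rightarrow> complex \<Rightarrow> complex" where
  "H_fun A B k \<Gamma> w P z =
     Delta_integral k \<Gamma> (\<lambda>x. (poly A z - poly A x + poly (pderiv A) x * (x - z)) / (x - z)\<^sup>2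
                              * poly P x * w x)
   + Delta_integral k \<Gamma> (\<lambda>x. (poly (E_poly A P + B) x - poly (E_poly A P + B) z) / (x - z)
                              * poly P x * w x)"

end

theory Submission
  imports Defs
begin

text \<open>
  Write \<open>\<Lambda> f\<close> for the integral of \<open>f w\<close> over the support of the weight. Since \<open>w' / w = B / A\<close>,
  \<open>(A f w)' = (A f' + (A' + B) f) w\<close>, so everything rests on integration by parts:
  \<open>\<Lambda> (A f' + (A' + B) f) = 0\<close> (the Pearson relation), for polynomials \<open>f\<close> and for
  \<open>f t = P t / (t - z)\<close> with \<open>z\<close> off the support.

  The Pearson relation requires that \<open>A f w\<close> tends to \<open>0\<close> at the ends of every arc, which is derived
  from the integrability of \<open>|x|^m |w| |dx|\<close>. The derivative of \<open>A f w\<close> along the arc is absolutely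
  integrable, so a limit \<open>l\<close> exists. If \<open>l \<noteq> 0\<close>, then \<open>1 / |A f|\<close> is bounded by a multiple of \<open>|w|\<close>
  near the end. At a zero \<open>a\<close> of \<open>A\<close> this makes the logarithmic derivative of \<open>\<gamma> - a\<close> integrable, so
  that \<open>\<gamma>\<close> could not reach \<open>a\<close>; at infinity it makes \<open>\<gamma>'\<close> integrable, so that \<open>\<gamma>\<close> could not be
  unbounded. See \<open>weighted_poly_vanishes_at_finite_end\<close>, \<open>weighted_poly_vanishes_at_infinite_end\<close>
  and \<open>integral_of_weighted_derivative_is_zero\<close>.

  Written as one integral over \<open>t\<close>, the partner \<open>S z\<close> has poles at \<open>t = z\<close>. Adding \<open>P z\<close> times the
  Pearson relation for \<open>P t / (t - z)\<close> does not change the value and cancels the poles, so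
  that \<open>S z = \<Lambda> (Q(z, \<cdot>))\<close> for a polynomial \<open>Q\<close> in both variables
  (\<open>partner_kernel_is_poly\<close>, \<open>electrostatic_partner_eq\<close>). Hence \<open>S\<close> is a polynomial, and it is
  determined by finitely many moments of \<open>w\<close>.

  The growth of \<open>S\<close> cannot be read off from the Cauchy transform itself, because the arcs may be
  unbounded and then the expansion of the transform in powers of \<open>1/z\<close> need not converge. But
  \<open>S\<close> does not change if \<open>\<Lambda>\<close> is replaced by a combination of finitely many point evaluations
  with the same low moments (\<open>quadrature\<close>). For such a combination the transform is a rational
  function \<open>C z = -m z^(-n-1) (1 + O(1/z))\<close>, the Pearson relation holds up to a high power of \<open>1/z\<close>,
  and expanding \<open>P (A C' - B C) - A P' C\<close> gives the coefficients \<open>N + n + 1\<close> and \<open>\<kappa>\<close>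
  (\<open>partner_asymptotics\<close>). The statement about the degree of \<open>S\<close> compares the two leading terms.

  Finally \<open>E\<close> and \<open>U\<close> are quotient and remainder of \<open>A P'\<close> by \<open>P\<close>. The integrands of \<open>H\<close>
  are \<open>P\<close> times polynomials of degree at most \<open>\<sigma> < n\<close>, and the Pearson relation for
  \<open>x^j P\<close> expresses \<open>\<Lambda> (x^j U)\<close> by integrals of \<open>P\<close> times polynomials of degree at most
  \<open>j + \<sigma> + 1 < n\<close>; both vanish by quasi-orthogonality.
\<close>

section \<open>Primitives on an open interval and their limits at the ends\<close>

lemma absolutely_integrable_continuous_dominated:
  fixes f :: "real \<Rightarrow> complex"
  assumes "finite S" "continuous_on ({p<..<q} - S) f" "b integrable_on {p<..<q}"
    and bound: "\<And>t. t \<in> {p<..<q} - S \<Longrightarrow> norm (f t) \<le> b t"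
  shows "f absolutely_integrable_on {p<..<q}"
proof -
  have op: "open ({p<..<q} - S)"
    using assms(1) by (simp add: finite_imp_closed open_Diff)
  have neg: "negligible (({p<..<q} - S - {p<..<q}) \<union> ({p<..<q} - ({p<..<q} - S)))"
    by (rule negligible_subset[of S]) (use assms(1) in \<open>auto simp: negligible_finite\<close>)
  have "b integrable_on ({p<..<q} - S)"
    using assms(3) by (rule integrable_spike_set) (rule negligible_subset[OF neg], blast)+
  moreover have "{p<..<q} - S \<in> sets lebesgue" using op by (simp add: borel_open)
  moreover from this have "f \<in> borel_measurable (lebesgue_on ({p<..<q} - S))"
    by (rule continuous_imp_measurable_on_sets_lebesgue[OF assms(2)])
  ultimately have "f absolutely_integrable_on ({p<..<q} - S)"
    using bound by (intro measurable_bounded_by_integrable_imp_absolutely_integrable)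
  then show ?thesis
    by (rule absolutely_integrable_spike_set) (rule negligible_subset[OF neg], blast)+
qed

text \<open>
  The right-hand side makes sense, and is continuous, on the closed interval: this is how an
  integrable derivative yields limits at the ends, where the values of \<open>\<phi>\<close> itself are arbitrary.
\<close>

lemma continuous_eq_integral_of_derivative:
  fixes \<phi> \<psi> :: "real \<Rightarrow> complex"
  assumes "p < q" "finite S" "continuous_on {p<..<q} \<phi>" "\<psi> integrable_on {p..q}"
    and deriv: "\<And>t. t \<in> {p<..<q} - S \<Longrightarrow> (\<phi> has_vector_derivative \<psi> t) (at t)"
  obtains c where "\<And>t. t \<in> {p<..<q} \<Longrightarrow> \<phi> t = c + integral {p..t} \<psi>"
proof -
  define r where "r = (p + q) / 2"
  have r: "r \<in> {p<..<q}" using \<open>p < q\<close> by (simp add: r_def)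
  have diff: "\<phi> t - integral {p..t} \<psi> = \<phi> s - integral {p..s} \<psi>"
    if st: "s \<in> {p<..<q}" "t \<in> {p<..<q}" "s \<le> t" for s t
  proof -
    have "(\<psi> has_integral \<phi> t - \<phi> s) {s..t}"
      by (rule fundamental_theorem_of_calculus_interior_strong[OF assms(2)])
         (use st deriv in \<open>auto intro: continuous_on_subset[OF assms(3)]\<close>)
    then have "integral {s..t} \<psi> = \<phi> t - \<phi> s" by (rule integral_unique)
    moreover have "integral {p..s} \<psi> + integral {s..t} \<psi> = integral {p..t} \<psi>"
      using st by (intro Henstock_Kurzweil_Integration.integral_combine integrable_subinterval_real[OF assms(4)]) auto
    ultimately show ?thesis by algebra
  qed
  have "\<phi> t - integral {p..t} \<psi> = \<phi> r - integral {p..r} \<psi>" if "t \<in> {p<..<q}" for t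
    using diff[of t r] diff[of r t] r that by (cases "t \<le> r") auto
  then show ?thesis
    by (intro that[of "\<phi> r - integral {p..r} \<psi>"]) (auto simp: algebra_simps)
qed

lemma endpoint_limit_exists:
  fixes \<phi> \<psi> :: "real \<Rightarrow> complex"
  assumes "p < q" "finite S" "continuous_on {p<..<q} \<phi>" "\<psi> integrable_on {p..q}"
    and deriv: "\<And>t. t \<in> {p<..<q} - S \<Longrightarrow> (\<phi> has_vector_derivative \<psi> t) (at t)"
    and e: "e \<in> {p..q}"
  shows "\<exists>l. (\<phi> \<longlongrightarrow> l) (at e within {p<..<q})"
proof -
  obtain c where c: "\<And>t. t \<in> {p<..<q} \<Longrightarrow> \<phi> t = c + integral {p..t} \<psi>"
    using continuous_eq_integral_of_derivative[OF assms(1-5)] by metis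
  have "continuous_on {p..q} (\<lambda>t. integral {p..t} \<psi>)"
    by (rule indefinite_integral_continuous_1[OF assms(4)])
  then have "((\<lambda>t. integral {p..t} \<psi>) \<longlongrightarrow> integral {p..e} \<psi>) (at e within {p..q})"
    using e by (auto simp: continuous_on_def)
  then have "((\<lambda>t. integral {p..t} \<psi>) \<longlongrightarrow> integral {p..e} \<psi>) (at e within {p<..<q})"
    by (rule tendsto_within_subset) auto
  then have lim: "((\<lambda>t. c + integral {p..t} \<psi>) \<longlongrightarrow> c + integral {p..e} \<psi>) (at e within {p<..<q})"
    by (intro tendsto_intros)
  have "\<forall>\<^sub>F t in at e within {p<..<q}. c + integral {p..t} \<psi> = \<phi> t"
    using c by (auto simp: eventually_at_filter)
  from Lim_transform_eventually[OF lim this] show ?thesis ..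
qed

text \<open>
  The linear equation \<open>\<phi>' = \<rho> \<phi>\<close> makes \<open>\<phi> exp (- \<integral> \<rho>)\<close> constant, and an integrable \<open>\<rho>\<close> keeps the
  exponential bounded away from \<open>0\<close> and \<open>\<infinity>\<close> up to the ends. So a solution cannot decay to \<open>0\<close>
  without being \<open>0\<close>. No logarithm of the complex function \<open>\<phi>\<close> has to be chosen.
\<close>

lemma zero_if_zero_limit_and_integrable_log_derivative:
  fixes \<phi> \<rho> :: "real \<Rightarrow> complex"
  assumes "p < q" "finite S" "continuous_on {p<..<q} \<phi>" "\<rho> integrable_on {p..q}"
    and cont: "continuous_on ({p<..<q} - S) \<rho>"
    and deriv: "\<And>t. t \<in> {p<..<q} - S \<Longrightarrow> (\<phi> has_vector_derivative \<rho> t * \<phi> t) (at t)"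
    and e: "e = p \<or> e = q" and lim: "(\<phi> \<longlongrightarrow> 0) (at e within {p<..<q})"
    and t: "t \<in> {p<..<q}"
  shows "\<phi> t = 0"
proof -
  define H where "H = (\<lambda>t. integral {p..t} \<rho>)"
  define y where "y = (\<lambda>t. \<phi> t * exp (- H t))"
  have contH: "continuous_on {p..q} H"
    unfolding H_def by (rule indefinite_integral_continuous_1[OF assms(4)])
  have op: "open ({p<..<q} - S)"
    using assms(2) by (simp add: finite_imp_closed open_Diff)
  have derH: "(H has_vector_derivative \<rho> t) (at t)" if t: "t \<in> {p<..<q} - S" for t
  proof -
    have "isCont \<rho> t"
      using cont op t by (simp add: continuous_on_eq_continuous_at)
    then have "continuous (at t within {p..q} - {}) \<rho>"
      by (rule continuous_at_imp_continuous_at_within)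
    then have "((\<lambda>u. integral {p..u} \<rho>) has_vector_derivative \<rho> t) (at t within {p..q} - {})"
      by (intro integral_has_vector_derivative_continuous_at[OF assms(4)]) (use t in auto)
    then have "((\<lambda>u. integral {p..u} \<rho>) has_vector_derivative \<rho> t) (at t within {p<..<q} - S)"
      by (rule has_vector_derivative_within_subset) auto
    then show ?thesis
      unfolding H_def at_within_open[OF t op] .
  qed
  have dery: "(y has_vector_derivative 0) (at t)" if t: "t \<in> {p<..<q} - S" for t
  proof -
    have "((\<lambda>t. exp (- H t)) has_vector_derivative (- \<rho> t) * exp (- H t)) (at t)"
      using field_vector_diff_chain_at[of "\<lambda>t. - H t" "- \<rho> t" t exp "exp (- H t)"]
        derH[OF t] by (auto intro!: derivative_eq_intros simp: o_def)
    from has_vector_derivative_mult[OF deriv[OF t] this]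
    show ?thesis by (simp add: y_def algebra_simps)
  qed
  have "y constant_on {p<..<q}"
  proof (rule has_derivative_zero_connected_constant_on[of _ S])
    show "continuous_on {p<..<q} y"
      unfolding y_def
      by (intro continuous_intros assms(3) continuous_on_subset[OF contH]) auto
    show "\<forall>x\<in>{p<..<q} - S. (y has_derivative (\<lambda>h. 0)) (at x within {p<..<q})"
      using dery by (auto simp: has_vector_derivative_def intro: has_derivative_at_withinI)
  qed (use assms in auto)
  then obtain c where c: "\<And>t. t \<in> {p<..<q} \<Longrightarrow> y t = c"
    by (auto simp: constant_on_def)
  have "(H \<longlongrightarrow> H e) (at e within {p..q})"
    using contH e \<open>p < q\<close> by (auto simp: continuous_on_def)
  then have "(H \<longlongrightarrow> H e) (at e within {p<..<q})"
    by (rule tendsto_within_subset) auto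
  from tendsto_mult[OF lim tendsto_exp[OF tendsto_minus[OF this]]]
  have lim0: "(y \<longlongrightarrow> 0) (at e within {p<..<q})" by (simp add: y_def)
  have "\<forall>\<^sub>F t in at e within {p<..<q}. y t = c"
    using c by (auto simp: eventually_at_filter)
  from Lim_transform_eventually[OF lim0 this]
  have "((\<lambda>t. c) \<longlongrightarrow> 0) (at e within {p<..<q})" .
  moreover have "at e within {p<..<q} \<noteq> bot"
    using e \<open>p < q\<close> by (auto simp: trivial_limit_within islimpt_greaterThanLessThan1
        islimpt_greaterThanLessThan2)
  ultimately have "c = 0" by (simp add: tendsto_const_iff)
  with c[OF t] show ?thesis by (simp add: y_def)
qed

section \<open>Regularity of the weight along an arc\<close>

lemma regular_analytic_atE:
  assumes "regular_analytic_at \<gamma> t"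
  obtains e where "e > 0" "\<And>s. \<bar>s - t\<bar> < e \<Longrightarrow> (\<gamma> has_vector_derivative vector_derivative \<gamma> (at s)) (at s)"
    "continuous_on {t-e<..<t+e} (\<lambda>s. vector_derivative \<gamma> (at s))"
proof -
  obtain g where g: "g analytic_on {of_real t}" and ev: "\<forall>\<^sub>F s in nhds t. \<gamma> s = g (of_real s)"
    using assms unfolding regular_analytic_at_def by auto
  obtain d where d: "d > 0" "\<And>s. \<bar>s - t\<bar> < d \<Longrightarrow> \<gamma> s = g (of_real s)"
    using ev by (auto simp: eventually_nhds_metric dist_real_def)
  obtain r where r: "r > 0" "g holomorphic_on ball (of_real t) r"
    using g by (auto simp: analytic_on_def)
  define e where "e = min d r"
  have e: "e > 0" using d r by (simp add: e_def)
  have inb: "complex_of_real s \<in> ball (of_real t) r" if "\<bar>s - t\<bar> < e" for s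
  proof -
    have "dist (complex_of_real t) (of_real s) = \<bar>t - s\<bar>"
      by (metis dist_of_real dist_real_def)
    then show ?thesis using that by (simp add: e_def abs_minus_commute)
  qed
  have vd: "(\<gamma> has_vector_derivative deriv g (of_real s)) (at s)" if s: "\<bar>s - t\<bar> < e" for s
  proof -
    have "(g has_field_derivative deriv g (of_real s)) (at (of_real s))"
      using holomorphic_derivI[OF r(2) open_ball inb[OF s]] by simp
    then have "((\<lambda>s. g (of_real s)) has_vector_derivative deriv g (of_real s)) (at s)"
      by (rule has_vector_derivative_real_field)
    moreover have "s \<in> {t-e<..<t+e}" using s by auto
    moreover have "g (of_real x) = \<gamma> x" if "x \<in> {t-e<..<t+e}" for x
    proof -
      have "\<bar>x - t\<bar> < d" using that by (auto simp: e_def)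
      then show ?thesis using d(2) by simp
    qed
    ultimately show ?thesis
      by (rule has_vector_derivative_transform_within_open[OF _ open_greaterThanLessThan])
  qed
  have eq: "vector_derivative \<gamma> (at s) = deriv g (of_real s)" if "\<bar>s - t\<bar> < e" for s
    using vd[OF that] by (rule vector_derivative_at)
  have "continuous_on {t-e<..<t+e} (\<lambda>s. deriv g (of_real s))"
    by (rule continuous_on_compose2[OF holomorphic_on_imp_continuous_on[OF
          holomorphic_deriv[OF r(2) open_ball]]])
       (use inb in \<open>auto intro!: continuous_intros\<close>)
  then have "continuous_on {t-e<..<t+e} (\<lambda>s. vector_derivative \<gamma> (at s))"
    by (subst continuous_on_cong[OF refl, where g = "\<lambda>s. deriv g (of_real s)"])
       (auto intro!: eq)
  moreover have "(\<gamma> has_vector_derivative vector_derivative \<gamma> (at s)) (at s)" if "\<bar>s - t\<bar> < e" for s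
    using vd eq that by simp
  ultimately show ?thesis using that e by blast
qed

text \<open>
  Limits from \<open>L\<close>, known to exist pointwise only, depend continuously on the boundary point: near
  \<open>x\<close> every value \<open>\<omega> y\<close> is approximated by values of \<open>h\<close> at points of \<open>L\<close> that are also near \<open>x\<close>.
\<close>

lemma boundary_values_continuous:
  fixes h \<omega> :: "'a::metric_space \<Rightarrow> 'b::metric_space"
  assumes "X \<inter> L = {}" "X \<subseteq> closure L"
    and lim: "\<And>x. x \<in> X \<Longrightarrow> (h \<longlongrightarrow> \<omega> x) (at x within L)"
  shows "continuous_on X \<omega>"
proof (unfold continuous_on_iff, intro ballI allI impI)
  fix x and \<epsilon> :: real assume x: "x \<in> X" and \<epsilon>: "\<epsilon> > 0"
  have near: "\<exists>d>0. \<forall>z\<in>L. dist z y < d \<longrightarrow> dist (h z) (\<omega> y) < \<epsilon> / 2" if y: "y \<in> X" for y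
  proof -
    have "\<epsilon> / 2 > 0" using \<epsilon> by simp
    then obtain d where d: "d > 0" "\<forall>z\<in>L. 0 < dist z y \<and> dist z y < d \<longrightarrow> dist (h z) (\<omega> y) < \<epsilon> / 2"
      using lim[OF y] unfolding Lim_within by blast
    have "0 < dist z y" if "z \<in> L" for z using that y assms(1) by auto
    with d show ?thesis by blast
  qed
  obtain d where d: "d > 0" "\<And>z. z \<in> L \<Longrightarrow> dist z x < d \<Longrightarrow> dist (h z) (\<omega> x) < \<epsilon> / 2"
    using near[OF x] by blast
  show "\<exists>d>0. \<forall>x'\<in>X. dist x' x < d \<longrightarrow> dist (\<omega> x') (\<omega> x) < \<epsilon>"
  proof (intro exI[of _ "d/2"] conjI ballI impI)
    fix y assume y: "y \<in> X" "dist y x < d / 2"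
    obtain d' where d': "d' > 0" "\<And>z. z \<in> L \<Longrightarrow> dist z y < d' \<Longrightarrow> dist (h z) (\<omega> y) < \<epsilon> / 2"
      using near[OF y(1)] by blast
    obtain z where z: "z \<in> L" "dist z y < min (d/2) d'"
    proof -
      have "y \<in> closure L" "min (d/2) d' > 0" using y(1) assms(2) d(1) d'(1) by auto
      then show ?thesis using that unfolding closure_approachable by blast
    qed
    have "dist z x < d" using z(2) y(2) dist_triangle[of z x y] by auto
    then show "dist (\<omega> y) (\<omega> x) < \<epsilon>"
      using d(2)[OF z(1)] d'(2)[OF z(1)] z(2) dist_triangle2[of "\<omega> y" "\<omega> x" "h z"]
      by (auto simp: dist_commute)
  qed (use d in auto)
qed

locale weighted_arc =
  fixes A B :: "complex poly" and \<gamma> :: "real \<Rightarrow> complex" and w :: "complex \<Rightarrow> complex"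
  assumes arc: "piecewise_analytic_jordan_arc (poly_zeros A) \<gamma>"
    and weight: "left_boundary_weight A B \<gamma> w"
    and moments: "\<And>m. (\<lambda>t. norm (\<gamma> t) ^ m * norm (w (\<gamma> t)) * norm (vector_derivative \<gamma> (at t)))
                        integrable_on {0<..<1}"
    and A_nonzero: "A \<noteq> 0"
begin

abbreviation d\<gamma> :: "real \<Rightarrow> complex" where "d\<gamma> t \<equiv> vector_derivative \<gamma> (at t)"

definition corners :: "real set" where
  "corners = {t \<in> {0<..<1}. \<not> regular_analytic_at \<gamma> t}"

lemma finite_corners: "finite corners"
proof -
  obtain S where "finite S" "\<forall>t\<in>{0<..<1} - S. regular_analytic_at \<gamma> t"
    using arc by (auto simp: piecewise_analytic_jordan_arc_def)
  then show ?thesis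
    by (intro finite_subset[of corners S]) (auto simp: corners_def)
qed

lemma open_smooth: "open ({0<..<1} - corners)"
  using finite_corners by (simp add: finite_imp_closed open_Diff)

lemma continuous_arc: "continuous_on {0<..<1} \<gamma>"
  using arc by (auto simp: piecewise_analytic_jordan_arc_def)

lemma inj_arc: "inj_on \<gamma> {0<..<1}"
  using arc by (auto simp: piecewise_analytic_jordan_arc_def)

lemma arc_nonzero: "t \<in> {0<..<1} \<Longrightarrow> poly A (\<gamma> t) \<noteq> 0"
  using arc unfolding piecewise_analytic_jordan_arc_def arc_interior_def poly_zeros_def by blast

lemma arc_has_derivative:
  assumes "t \<in> {0<..<1} - corners"
  shows "(\<gamma> has_vector_derivative d\<gamma> t) (at t)"
proof -
  have "regular_analytic_at \<gamma> t" using assms by (auto simp: corners_def)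
  then show ?thesis by (rule regular_analytic_atE) auto
qed

lemma continuous_arc_derivative: "continuous_on ({0<..<1} - corners) d\<gamma>"
proof (rule continuous_at_imp_continuous_on, rule ballI)
  fix t assume "t \<in> {0<..<1} - corners"
  then have "regular_analytic_at \<gamma> t" by (auto simp: corners_def)
  then obtain e where "e > 0" "continuous_on {t-e<..<t+e} d\<gamma>"
    by (rule regular_analytic_atE)
  then show "isCont d\<gamma> t"
    by (simp add: continuous_on_eq_continuous_at)
qed

text \<open>
  The rectangle \<open>{t-d<..<t+d} \<times> {0<..<e}\<close> is mapped to the left of the arc. It can be chosen so
  small that its image stays in a given disc around \<open>\<gamma> t\<close>, where \<open>B / A\<close> will have a primitive.
\<close>

lemma left_box_in_neighbourhood:
  assumes L: "left_neighbourhood \<gamma> L" and t: "t \<in> {0<..<1} - corners" and r: "r > 0"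
  obtains d e where "d > 0" "e > 0" "{t-d<..<t+d} \<subseteq> {0<..<1} - corners"
    "\<And>s. s \<in> {t-d<..<t+d} \<Longrightarrow> \<gamma> s \<in> ball (\<gamma> t) r"
    "\<And>s y. s \<in> {t-d<..<t+d} \<Longrightarrow> y \<in> {0<..<e} \<Longrightarrow> \<gamma> s + \<i> * of_real y * d\<gamma> s \<in> L \<inter> ball (\<gamma> t) r"
proof -
  have "regular_analytic_at \<gamma> t" using t by (auto simp: corners_def)
  then have "\<forall>\<^sub>F (s, y) in nhds t \<times>\<^sub>F at_right 0. \<gamma> s + \<i> * of_real y * d\<gamma> s \<in> L"
    using L t by (auto simp: left_neighbourhood_def)
  then obtain P Q where P: "eventually P (nhds t)" and Q: "eventually Q (at_right (0::real))"
    and PQ: "\<And>s y. P s \<Longrightarrow> Q y \<Longrightarrow> \<gamma> s + \<i> * of_real y * d\<gamma> s \<in> L"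
    unfolding eventually_prod_filter by auto
  have "isCont \<gamma> t" "isCont d\<gamma> t"
    using continuous_arc continuous_arc_derivative open_smooth t
    by (simp_all add: continuous_on_eq_continuous_at)
  then have lim: "(\<gamma> \<longlongrightarrow> \<gamma> t) (nhds t)" "(d\<gamma> \<longlongrightarrow> d\<gamma> t) (nhds t)"
    by (simp_all add: continuous_at tendsto_nhds_iff)
  define M where "M = norm (d\<gamma> t) + 1"
  have M: "M > 0" by (simp add: M_def add_nonneg_pos)
  have ev1: "\<forall>\<^sub>F s in nhds t. dist (\<gamma> s) (\<gamma> t) < r / 2"
    using tendstoD[OF lim(1), of "r/2"] r by simp
  have ev2: "\<forall>\<^sub>F s in nhds t. norm (d\<gamma> s) < M"
    using order_tendstoD(2)[OF tendsto_norm[OF lim(2)], of M] by (simp add: M_def)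
  have ev3: "\<forall>\<^sub>F s in nhds t. s \<in> {0<..<1} - corners"
    using open_smooth t eventually_nhds by blast
  have "\<forall>\<^sub>F s in nhds t. P s \<and> dist (\<gamma> s) (\<gamma> t) < r / 2 \<and> norm (d\<gamma> s) < M \<and> s \<in> {0<..<1} - corners"
    using P ev1 ev2 ev3 by (intro eventually_conj)
  then obtain d where d: "d > 0" "\<And>s. dist s t < d \<Longrightarrow>
      P s \<and> dist (\<gamma> s) (\<gamma> t) < r / 2 \<and> norm (d\<gamma> s) < M \<and> s \<in> {0<..<1} - corners"
    unfolding eventually_nhds_metric by blast
  have d': "P s \<and> dist (\<gamma> s) (\<gamma> t) < r / 2 \<and> norm (d\<gamma> s) < M \<and> s \<in> {0<..<1} - corners"
    if "s \<in> {t-d<..<t+d}" for s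
  proof -
    have "dist s t < d" using that by (auto simp: dist_real_def)
    then show ?thesis by (rule d(2))
  qed
  obtain e0 where e0: "e0 > 0" "\<And>y. 0 < y \<Longrightarrow> y < e0 \<Longrightarrow> Q y"
    using Q unfolding eventually_at_right_field by auto
  define e where "e = min e0 (r / (2 * M))"
  show ?thesis
  proof (rule that[of d e])
    fix s y assume s: "s \<in> {t-d<..<t+d}" and y: "y \<in> {0<..<e}"
    have "y * M < r / 2" using y M by (auto simp: e_def field_simps)
    moreover have "y * norm (d\<gamma> s) \<le> y * M" using d'[OF s] y by (intro mult_left_mono) auto
    ultimately have "y * norm (d\<gamma> s) < r / 2" by linarith
    then have *: "norm (\<i> * of_real y * d\<gamma> s) < r / 2" using y by (simp add: norm_mult)
    have "dist (\<gamma> t) (\<gamma> s + \<i> * of_real y * d\<gamma> s) \<le> dist (\<gamma> t) (\<gamma> s) + norm (\<i> * of_real y * d\<gamma> s)"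
      using dist_triangle[of "\<gamma> t" "\<gamma> s + \<i> * of_real y * d\<gamma> s" "\<gamma> s"] by (simp add: dist_norm)
    also have "\<dots> < r" using d'[OF s] * by (simp add: dist_commute)
    finally show "\<gamma> s + \<i> * of_real y * d\<gamma> s \<in> L \<inter> ball (\<gamma> t) r"
      using PQ[of s y] d'[OF s] e0 y by (auto simp: e_def)
  next
    fix s assume s: "s \<in> {t-d<..<t+d}"
    show "\<gamma> s \<in> ball (\<gamma> t) r" using d'[OF s] r by (simp add: dist_commute)
  next
    show "{t-d<..<t+d} \<subseteq> {0<..<1} - corners" using d' by blast
    show "e > 0" using e0(1) M r by (simp add: e_def)
  qed (rule d(1))
qed

lemma box_path_tendsto:
  "((\<lambda>y::real. \<gamma> s + \<i> * of_real y * d\<gamma> s) \<longlongrightarrow> \<gamma> s) (at_right 0)"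
proof -
  have "((\<lambda>y::real. \<gamma> s + \<i> * of_real y * d\<gamma> s) \<longlongrightarrow> \<gamma> s + \<i> * of_real 0 * d\<gamma> s) (at_right 0)"
    by (intro tendsto_intros)
  then show ?thesis by simp
qed

lemma smooth_point_in_closure:
  assumes L: "left_neighbourhood \<gamma> L" and t: "t \<in> {0<..<1} - corners"
  shows "\<gamma> t \<in> closure L"
proof -
  obtain d e where de: "d > 0" "(e::real) > 0"
    "\<And>s y. s \<in> {t-d<..<t+d} \<Longrightarrow> y \<in> {0<..<e} \<Longrightarrow> \<gamma> s + \<i> * of_real y * d\<gamma> s \<in> L \<inter> ball (\<gamma> t) 1"
    using left_box_in_neighbourhood[OF L t zero_less_one] by metis
  have "\<forall>\<^sub>F y in at_right 0. \<gamma> t + \<i> * of_real y * d\<gamma> t \<in> closure L"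
    unfolding eventually_at_right_field
  proof (intro exI conjI allI impI)
    show "0 < e" by fact
    fix y assume "0 < y" "y < e"
    then show "\<gamma> t + \<i> * of_real y * d\<gamma> t \<in> closure L"
      using de(3)[of t y] de(1) closure_subset[of L] by auto
  qed
  from Lim_in_closed_set[OF closed_closure this _ box_path_tendsto]
  show ?thesis by simp
qed

text \<open>
  A corner is a limit of smooth points, because there are only finitely many corners. Hence the
  boundary values of the weight are honest limits at corners as well.
\<close>

lemma interior_in_closure:
  assumes L: "left_neighbourhood \<gamma> L"
  shows "arc_interior \<gamma> \<subseteq> closure L"
proof
  fix z assume "z \<in> arc_interior \<gamma>"
  then obtain t where t: "t \<in> {0<..<1}" "z = \<gamma> t" by (auto simp: arc_interior_def)
  have "isCont \<gamma> t" using continuous_arc t by (simp add: continuous_on_eq_continuous_at)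
  then have lim: "(\<gamma> \<longlongrightarrow> \<gamma> t) (at t)" by (simp add: isCont_def)
  have "open ({0<..<1} - (corners - {t}))" using finite_corners by (simp add: finite_imp_closed open_Diff)
  moreover have "t \<in> {0<..<1} - (corners - {t})" using t by auto
  ultimately have "\<forall>\<^sub>F s in at t. s \<in> {0<..<1} - (corners - {t})"
    using eventually_at_topological by blast
  moreover have "\<forall>\<^sub>F s in at t. s \<noteq> t" by (simp add: eventually_at_filter)
  ultimately have "\<forall>\<^sub>F s in at t. \<gamma> s \<in> closure L"
    by eventually_elim (use smooth_point_in_closure[OF L] in auto)
  from Lim_in_closed_set[OF closed_closure this _ lim] show "z \<in> closure L"
    using t by simp
qed

lemma weight_continuous: "continuous_on {0<..<1} (\<lambda>t. w (\<gamma> t))"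
proof -
  obtain L F c where L: "left_neighbourhood \<gamma> L"
    and lim: "\<And>t. t\<in>{0<..<1} \<Longrightarrow> ((\<lambda>z. c * exp (F z)) \<longlongrightarrow> w (\<gamma> t)) (at (\<gamma> t) within L)"
    using weight unfolding left_boundary_weight_def by blast
  have "continuous_on (arc_interior \<gamma>) w"
    by (rule boundary_values_continuous[of _ L "\<lambda>z. c * exp (F z)"])
       (use L lim interior_in_closure[OF L] in \<open>auto simp: left_neighbourhood_def arc_interior_def\<close>)
  then show ?thesis
    using continuous_arc by (rule continuous_on_compose2) (auto simp: arc_interior_def)
qed

text \<open>
  Near a smooth point \<open>\<gamma> t\<close> take a primitive \<open>G\<close> of \<open>B / A\<close> on a disc. On the image of a rectangle to
  the left of the arc, which is connected, the branch \<open>F\<close> differs from \<open>G\<close> by a constant. Approaching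
  the arc along the normals gives \<open>w (\<gamma> s) = c exp C exp (G (\<gamma> s))\<close> near \<open>t\<close>, where the right-hand side
  is differentiable.
\<close>

lemma weight_has_derivative:
  assumes t: "t \<in> {0<..<1} - corners"
  shows "((\<lambda>t. w (\<gamma> t)) has_vector_derivative
           poly B (\<gamma> t) / poly A (\<gamma> t) * w (\<gamma> t) * d\<gamma> t) (at t)"
proof -
  obtain L F c where L: "left_neighbourhood \<gamma> L" and LA: "L \<inter> poly_zeros A = {}"
    and F: "\<And>z. z \<in> L \<Longrightarrow> (F has_field_derivative poly B z / poly A z) (at z)"
    and lim: "\<And>t. t\<in>{0<..<1} \<Longrightarrow> ((\<lambda>z. c * exp (F z)) \<longlongrightarrow> w (\<gamma> t)) (at (\<gamma> t) within L)"
    using weight unfolding left_boundary_weight_def by blast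
  have opL: "open L" and Larc: "L \<inter> arc_interior \<gamma> = {}" using L by (auto simp: left_neighbourhood_def)
  have "open (- poly_zeros A)"
    using A_nonzero by (simp add: open_Compl finite_imp_closed poly_zeros_def poly_roots_finite)
  moreover have "\<gamma> t \<in> - poly_zeros A" using arc_nonzero t by (auto simp: poly_zeros_def)
  ultimately obtain r where r: "r > 0" "ball (\<gamma> t) r \<subseteq> - poly_zeros A"
    using open_contains_ball by blast
  define U where "U = ball (\<gamma> t) r"
  have "(\<lambda>z. poly B z / poly A z) holomorphic_on U"
    using r by (intro holomorphic_intros) (auto simp: poly_zeros_def U_def)
  then obtain G where "\<And>z. z \<in> U \<Longrightarrow> (G has_field_derivative poly B z / poly A z) (at z within U)"
    using holomorphic_convex_primitive'[of U "\<lambda>z. poly B z / poly A z"] by (auto simp: U_def)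
  then have G: "(G has_field_derivative poly B z / poly A z) (at z)" if "z \<in> U" for z
    using that by (metis U_def at_within_open open_ball)
  obtain d e where de: "d > 0" "e > 0" "{t-d<..<t+d} \<subseteq> {0<..<1} - corners"
    and inU: "\<And>s. s \<in> {t-d<..<t+d} \<Longrightarrow> \<gamma> s \<in> U"
    and box: "\<And>s y. s \<in> {t-d<..<t+d} \<Longrightarrow> y \<in> {0<..<e} \<Longrightarrow> \<gamma> s + \<i> * of_real y * d\<gamma> s \<in> L \<inter> U"
    using left_box_in_neighbourhood[OF L t r(1)] unfolding U_def by metis
  define X where "X = (\<lambda>(s, y). \<gamma> s + \<i> * of_real y * d\<gamma> s) ` ({t-d<..<t+d} \<times> {0<..<e})"
  have conX: "connected X"
    unfolding X_def
  proof (rule connected_continuous_image)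
    have "continuous_on {t-d<..<t+d} \<gamma>"
      by (rule continuous_on_subset[OF continuous_arc]) (use de(3) in auto)
    then have 1: "continuous_on ({t-d<..<t+d} \<times> {0<..<e}) (\<lambda>x. \<gamma> (fst x))"
      by (rule continuous_on_compose2[OF _ continuous_on_fst[OF continuous_on_id]]) auto
    have "continuous_on {t-d<..<t+d} d\<gamma>"
      by (rule continuous_on_subset[OF continuous_arc_derivative de(3)])
    then have 2: "continuous_on ({t-d<..<t+d} \<times> {0<..<e}) (\<lambda>x. d\<gamma> (fst x))"
      by (rule continuous_on_compose2[OF _ continuous_on_fst[OF continuous_on_id]]) auto
    show "continuous_on ({t-d<..<t+d} \<times> {0<..<e}) (\<lambda>(s, y). \<gamma> s + \<i> * of_real y * d\<gamma> s)"
      unfolding case_prod_beta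
      by (intro continuous_intros 1 2)
  qed (simp add: connected_Times)
  have XLU: "X \<subseteq> L \<inter> U" using box by (auto simp: X_def)
  have Xne: "X \<noteq> {}" using de by (auto simp: X_def)
  then obtain x0 where x0: "x0 \<in> X" by auto
  \<comment> \<open>\<open>F - G\<close> is constant on connected open sets only; the image of the rectangle need not be
    open, so pass to the component of \<open>L \<inter> U\<close> that contains it.\<close>
  define V where "V = connected_component_set (L \<inter> U) x0"
  have XV: "X \<subseteq> V" unfolding V_def
    using connected_component_maximal[OF x0 conX XLU] .
  have VLU: "V \<subseteq> L \<inter> U" unfolding V_def by (rule connected_component_subset)
  have "open V" using opL by (simp add: V_def U_def open_Int open_connected_component)
  moreover have "connected V" by (simp add: V_def)
  moreover have D: "((\<lambda>z. F z - G z) has_field_derivative 0) (at z)" if "z \<in> V" for z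
    using DERIV_diff[OF F[of z] G[of z]] that VLU by auto
  moreover have "continuous_on V (\<lambda>z. F z - G z)"
    using D DERIV_isCont by (blast intro: continuous_at_imp_continuous_on)
  ultimately obtain C where C: "\<And>z. z \<in> V \<Longrightarrow> F z - G z = C"
    using DERIV_zero_connected_constant[of V "{}" "\<lambda>z. F z - G z"] by auto
  have eq: "w (\<gamma> s) = c * exp C * exp (G (\<gamma> s))" if s: "s \<in> {t-d<..<t+d}" for s
  proof -
    let ?p = "\<lambda>y::real. \<gamma> s + \<i> * of_real y * d\<gamma> s"
    have s01: "s \<in> {0<..<1}" using s de(3) by auto
    have evY: "\<forall>\<^sub>F y in at_right 0. y \<in> {0<..<e}"
      using de(2) eventually_at_right_real by blast
    have "\<forall>\<^sub>F y in at_right 0. ?p y \<in> L \<and> ?p y \<noteq> \<gamma> s"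
      using evY
    proof eventually_elim
      case (elim y)
      then have "?p y \<in> L" using box[OF s] by auto
      moreover have "\<gamma> s \<notin> L" using Larc s01 by (auto simp: arc_interior_def)
      ultimately show ?case by metis
    qed
    then have "filterlim ?p (at (\<gamma> s) within L) (at_right 0)"
      using box_path_tendsto by (auto simp: filterlim_at)
    from filterlim_compose[OF lim[OF s01] this]
    have 1: "((\<lambda>y. c * exp (F (?p y))) \<longlongrightarrow> w (\<gamma> s)) (at_right 0)" .
    have "isCont G (\<gamma> s)" using G[OF inU[OF s]] by (rule DERIV_isCont)
    from isCont_tendsto_compose[OF this box_path_tendsto]
    have "((\<lambda>y. c * exp C * exp (G (?p y))) \<longlongrightarrow> c * exp C * exp (G (\<gamma> s))) (at_right 0)"
      by (intro tendsto_intros)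
    moreover have "\<forall>\<^sub>F y in at_right 0. c * exp C * exp (G (?p y)) = c * exp (F (?p y))"
      using evY
    proof eventually_elim
      case (elim y)
      then have "?p y \<in> V" using XV s by (force simp: X_def)
      then have "F (?p y) = C + G (?p y)" using C by (metis add.commute diff_add_cancel)
      then show ?case by (simp add: exp_add)
    qed
    ultimately have "((\<lambda>y. c * exp (F (?p y))) \<longlongrightarrow> c * exp C * exp (G (\<gamma> s))) (at_right 0)"
      by (rule Lim_transform_eventually)
    with 1 show ?thesis by (rule tendsto_unique[rotated]) simp
  qed
  have tin: "t \<in> {t-d<..<t+d}" using de(1) by auto
  have "((\<lambda>z. c * exp C * exp (G z)) has_field_derivative
          c * exp C * exp (G (\<gamma> t)) * (poly B (\<gamma> t) / poly A (\<gamma> t))) (at (\<gamma> t))"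
    using G[OF inU[OF tin]] by (auto intro!: derivative_eq_intros)
  from field_vector_diff_chain_at[OF arc_has_derivative[OF t] this]
  have "((\<lambda>s. c * exp C * exp (G (\<gamma> s))) has_vector_derivative
       d\<gamma> t * (c * exp C * exp (G (\<gamma> t)) * (poly B (\<gamma> t) / poly A (\<gamma> t)))) (at t)"
    unfolding o_def .
  then have "((\<lambda>s. w (\<gamma> s)) has_vector_derivative
       d\<gamma> t * (c * exp C * exp (G (\<gamma> t)) * (poly B (\<gamma> t) / poly A (\<gamma> t)))) (at t)"
    by (rule has_vector_derivative_transform_within_open[OF _ open_greaterThanLessThan tin])
       (use eq in auto)
  then show ?thesis
    by (simp add: eq[OF tin] mult_ac)
qed

end

section \<open>Vanishing of the boundary terms\<close>

lemma at_end_within_open_unit_interval: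
  "at (0::real) within {0<..<1} = at_right 0" "at (1::real) within {0<..<1} = at_left 1"
  by (rule at_within_nhd[of _ "{-1<..<1}"] at_within_nhd[of _ "{0<..<2}"]; auto)+

lemma eventually_at_end_on_subinterval:
  fixes e :: real
  assumes e: "e = 0 \<or> e = 1" and ev: "eventually P (at e within {0<..<1})"
  obtains p q where "0 \<le> p" "p < q" "q \<le> 1" "e = p \<or> e = q" "\<And>t. t \<in> {p<..<q} \<Longrightarrow> P t"
  using e
proof
  assume "e = 0"
  then obtain b where "b > 0" "\<And>t. 0 < t \<Longrightarrow> t < b \<Longrightarrow> P t"
    using ev by (auto simp: at_end_within_open_unit_interval eventually_at_right_field)
  then show ?thesis using \<open>e = 0\<close> by (intro that[of 0 "min b 1"]) auto
next
  assume "e = 1"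
  then obtain b where "b < 1" "\<And>t. b < t \<Longrightarrow> t < 1 \<Longrightarrow> P t"
    using ev by (auto simp: at_end_within_open_unit_interval eventually_at_left_field)
  then show ?thesis using \<open>e = 1\<close> by (intro that[of "max b 0" 1]) auto
qed

context weighted_arc
begin

abbreviation integrand :: "(complex \<Rightarrow> complex) \<Rightarrow> real \<Rightarrow> complex" where
  "integrand f t \<equiv> f (\<gamma> t) * w (\<gamma> t) * d\<gamma> t"

lemma integrable_poly_bound:
  fixes p :: "complex poly"
  shows "(\<lambda>t. (\<Sum>i\<le>degree p. norm (coeff p i) * norm (\<gamma> t) ^ i) * norm (w (\<gamma> t)) * norm (d\<gamma> t))
     integrable_on {0<..<1}"
proof -
  have "(\<lambda>t. \<Sum>i\<le>degree p. norm (coeff p i) * (norm (\<gamma> t) ^ i * norm (w (\<gamma> t)) * norm (d\<gamma> t)))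
     integrable_on {0<..<1}"
    by (intro integrable_sum integrable_on_mult_right moments) auto
  then show ?thesis by (simp add: sum_distrib_right mult.assoc)
qed

lemma norm_poly_le_sum: "norm (poly p (x::complex)) \<le> (\<Sum>i\<le>degree p. norm (coeff p i) * norm x ^ i)"
  unfolding poly_altdef by (rule sum_norm_le) (simp add: norm_mult norm_power)

lemma absolutely_integrable_dominated_by_weighted_poly:
  fixes h :: "real \<Rightarrow> complex"
  assumes pq: "0 \<le> p" "q \<le> 1" and h: "continuous_on ({p<..<q} - corners) h"
    and bound: "\<And>t. t \<in> {p<..<q} \<Longrightarrow> norm (h t) \<le> C * norm (integrand (poly f) t)"
  shows "h absolutely_integrable_on {p<..<q}"
proof -
  define b where "b = (\<lambda>t. \<bar>C\<bar> * ((\<Sum>i\<le>degree f. norm (coeff f i) * norm (\<gamma> t) ^ i) * norm (w (\<gamma> t)) * norm (d\<gamma> t)))"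
  have "b integrable_on {0<..<1}"
    unfolding b_def by (intro integrable_on_mult_right integrable_poly_bound)
  then have "b integrable_on {p<..<q}"
    by (metis b_def absolutely_integrable_on_subinterval integrable_on_open_interval_real
        integrable_subinterval_real atLeastatMost_subset_iff pq)
  then show ?thesis
  proof (rule absolutely_integrable_continuous_dominated[OF finite_corners h])
    fix t assume t: "t \<in> {p<..<q} - corners"
    have "C * norm (integrand (poly f) t) \<le> \<bar>C\<bar> * norm (integrand (poly f) t)"
      by (intro mult_right_mono) auto
    also have "\<dots> \<le> b t"
      unfolding b_def norm_mult by (intro mult_left_mono mult_right_mono norm_poly_le_sum) auto
    finally show "norm (h t) \<le> b t" using bound[of t] t by auto
  qed
qed

lemma weighted_absolutely_integrable:
  assumes f: "continuous_on (arc_interior \<gamma>) f"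
    and bound: "\<And>x. x \<in> arc_interior \<gamma> \<Longrightarrow> norm (f x) \<le> C * norm (poly p x)"
  shows "integrand f absolutely_integrable_on {0<..<1}"
proof (rule absolutely_integrable_dominated_by_weighted_poly)
  have "continuous_on {0<..<1} (\<lambda>t. f (\<gamma> t))"
    using f continuous_arc by (rule continuous_on_compose2) (auto simp: arc_interior_def)
  then show "continuous_on ({0<..<1} - corners) (integrand f)"
    by (intro continuous_intros continuous_arc_derivative)
       (auto intro: continuous_on_subset weight_continuous)
  fix t :: real assume "t \<in> {0<..<1}"
  then have "norm (f (\<gamma> t)) \<le> C * norm (poly p (\<gamma> t))" using bound by (auto simp: arc_interior_def)
  then show "norm (integrand f t) \<le> C * norm (integrand (poly p) t)"
    by (simp add: norm_mult mult_right_mono flip: mult.assoc)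
qed auto

lemma weighted_poly_absolutely_integrable: "integrand (poly p) absolutely_integrable_on {0<..<1}"
  by (rule weighted_absolutely_integrable[of _ 1 p]) (auto intro: continuous_intros)

lemma weight_times_fA_has_derivative:
  assumes t: "t \<in> {0<..<1} - corners" and f: "(f has_field_derivative f') (at (\<gamma> t))"
  shows "((\<lambda>t. f (\<gamma> t) * poly A (\<gamma> t) * w (\<gamma> t)) has_vector_derivative
     (poly A (\<gamma> t) * f' + poly (pderiv A + B) (\<gamma> t) * f (\<gamma> t)) * w (\<gamma> t) * d\<gamma> t) (at t)"
proof -
  have "((\<lambda>x. f x * poly A x) has_field_derivative
      f' * poly A (\<gamma> t) + poly (pderiv A) (\<gamma> t) * f (\<gamma> t)) (at (\<gamma> t))"
    by (rule DERIV_mult[OF f poly_DERIV])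
  from field_vector_diff_chain_at[OF arc_has_derivative[OF t] this]
  have "((\<lambda>t. f (\<gamma> t) * poly A (\<gamma> t)) has_vector_derivative
     d\<gamma> t * (f' * poly A (\<gamma> t) + poly (pderiv A) (\<gamma> t) * f (\<gamma> t))) (at t)" by (simp add: o_def)
  from has_vector_derivative_mult[OF this weight_has_derivative[OF t]]
  show ?thesis
    by (rule back_subst[where P = "\<lambda>d. (_ has_vector_derivative d) _"])
       (use arc_nonzero[of t] t in \<open>simp add: field_simps\<close>)
qed

lemma weighted_poly_end_limit_exists:
  assumes e: "e = 0 \<or> e = 1"
  shows "\<exists>l. ((\<lambda>t. poly f (\<gamma> t) * poly A (\<gamma> t) * w (\<gamma> t)) \<longlongrightarrow> l) (at e within {0<..<1})"
proof (rule endpoint_limit_exists[OF _ finite_corners])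
  let ?g = "A * pderiv f + (pderiv A + B) * f"
  show "continuous_on {0<..<1} (\<lambda>t. poly f (\<gamma> t) * poly A (\<gamma> t) * w (\<gamma> t))"
    by (intro continuous_intros continuous_arc weight_continuous)
  show "integrand (poly ?g) integrable_on {0..1}"
    using weighted_poly_absolutely_integrable[of ?g] integrable_on_open_interval_real
      set_lebesgue_integral_eq_integral(1) by blast
  show "((\<lambda>t. poly f (\<gamma> t) * poly A (\<gamma> t) * w (\<gamma> t)) has_vector_derivative integrand (poly ?g) t) (at t)"
    if "t \<in> {0<..<1} - corners" for t
    using weight_times_fA_has_derivative[OF that poly_DERIV] by simp
  show "e \<in> {0..1}" using e by auto
qed simp

text \<open>
  If the limit \<open>l\<close> were not \<open>0\<close>, then \<open>|w| \<ge> const / |\<gamma> - a|\<close> near the end, as \<open>A\<close> vanishes at \<open>a\<close>. Then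
  \<open>\<gamma>' / (\<gamma> - a)\<close> would be dominated by the integrable function \<open>|w| |\<gamma>'|\<close>, which excludes \<open>\<gamma> \<longlongrightarrow> a\<close>.
\<close>

lemma weighted_poly_vanishes_at_finite_end:
  assumes e: "e = 0 \<or> e = 1" and lim: "(\<gamma> \<longlongrightarrow> a) (at e within {0<..<1})" and a: "poly A a = 0"
  shows "((\<lambda>t. poly A (\<gamma> t) * w (\<gamma> t)) \<longlongrightarrow> 0) (at e within {0<..<1})"
proof -
  obtain l where l: "((\<lambda>t. poly A (\<gamma> t) * w (\<gamma> t)) \<longlongrightarrow> l) (at e within {0<..<1})"
    using weighted_poly_end_limit_exists[OF e, of 1] by auto
  have "l = 0"
  proof (rule ccontr)
    assume "l \<noteq> 0"
    obtain A1 where A1: "A = [:-a, 1:] * A1" using a by (auto simp: poly_eq_0_iff_dvd)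
    define K where "K = norm (poly A1 a) + 1"
    have limA1: "((\<lambda>t. poly A1 (\<gamma> t)) \<longlongrightarrow> poly A1 a) (at e within {0<..<1})"
      by (intro tendsto_intros lim)
    have "\<forall>\<^sub>F t in at e within {0<..<1}. norm (poly A1 (\<gamma> t)) < K"
      using order_tendstoD(2)[OF tendsto_norm[OF limA1], of K] by (simp add: K_def)
    moreover have "\<forall>\<^sub>F t in at e within {0<..<1}. norm l / 2 < norm (poly A (\<gamma> t) * w (\<gamma> t))"
      using order_tendstoD(1)[OF tendsto_norm[OF l], of "norm l / 2"] \<open>l \<noteq> 0\<close> by simp
    ultimately have "\<forall>\<^sub>F t in at e within {0<..<1}. norm (poly A1 (\<gamma> t)) < K \<and>
        norm l / 2 < norm (poly A (\<gamma> t) * w (\<gamma> t))" by (rule eventually_conj)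
    then obtain p q where pq: "0 \<le> p" "p < q" "q \<le> 1" "e = p \<or> e = q"
      and K: "\<And>t. t \<in> {p<..<q} \<Longrightarrow> norm (poly A1 (\<gamma> t)) < K"
      and L: "\<And>t. t \<in> {p<..<q} \<Longrightarrow> norm l / 2 < norm (poly A (\<gamma> t) * w (\<gamma> t))"
      by (rule eventually_at_end_on_subinterval[OF e]) blast
    have sub: "{p<..<q} \<subseteq> {0<..<1}" using pq by auto
    have ne: "\<gamma> t \<noteq> a" if "t \<in> {p<..<q}" for t using arc_nonzero[of t] a sub that by auto
    define \<rho> where "\<rho> = (\<lambda>t. d\<gamma> t / (\<gamma> t - a))"
    have cont\<rho>: "continuous_on ({p<..<q} - corners) \<rho>"
      unfolding \<rho>_def using sub ne
      by (intro continuous_intros continuous_on_subset[OF continuous_arc]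
          continuous_on_subset[OF continuous_arc_derivative]) auto
    have "\<rho> absolutely_integrable_on {p<..<q}"
    proof (rule absolutely_integrable_dominated_by_weighted_poly[OF pq(1,3) cont\<rho>])
      fix t assume t: "t \<in> {p<..<q}"
      have "poly A (\<gamma> t) = (\<gamma> t - a) * poly A1 (\<gamma> t)" by (simp add: A1 algebra_simps)
      then have "norm l / 2 \<le> norm (\<gamma> t - a) * norm (poly A1 (\<gamma> t)) * norm (w (\<gamma> t))"
        using L[OF t] by (simp only: norm_mult)
      also have "\<dots> \<le> norm (\<gamma> t - a) * K * norm (w (\<gamma> t))"
        using K[OF t] by (intro mult_left_mono mult_right_mono) auto
      finally have "1 / norm (\<gamma> t - a) \<le> (2 * K / norm l) * norm (w (\<gamma> t))"
        using ne[OF t] \<open>l \<noteq> 0\<close> by (simp add: field_simps)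
      then have "norm (d\<gamma> t) * (1 / norm (\<gamma> t - a)) \<le> norm (d\<gamma> t) * ((2 * K / norm l) * norm (w (\<gamma> t)))"
        by (rule mult_left_mono) simp
      then show "norm (\<rho> t) \<le> (2 * K / norm l) * norm (integrand (poly 1) t)"
        by (simp add: \<rho>_def norm_divide norm_mult mult_ac)
    qed
    then have int: "\<rho> integrable_on {p..q}"
      using integrable_on_open_interval_real set_lebesgue_integral_eq_integral(1) by blast
    have "\<gamma> ((p + q) / 2) - a = 0"
    proof (rule zero_if_zero_limit_and_integrable_log_derivative[OF pq(2) finite_corners _ int cont\<rho> _ pq(4)])
      show "continuous_on {p<..<q} (\<lambda>t. \<gamma> t - a)"
        by (intro continuous_intros continuous_on_subset[OF continuous_arc sub])
      show "((\<lambda>t. \<gamma> t - a) \<longlongrightarrow> 0) (at e within {p<..<q})"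
        using tendsto_within_subset[OF lim sub] by (simp add: LIM_zero_iff)
      fix t assume t: "t \<in> {p<..<q} - corners"
      have "((\<lambda>t. \<gamma> t - a) has_vector_derivative d\<gamma> t) (at t)"
        using arc_has_derivative[of t] t sub by (auto intro!: derivative_eq_intros)
      then show "((\<lambda>t. \<gamma> t - a) has_vector_derivative \<rho> t * (\<gamma> t - a)) (at t)"
        using ne[of t] t by (simp add: \<rho>_def)
    qed (use pq in auto)
    then show False using ne[of "(p + q) / 2"] pq by auto
  qed
  with l show ?thesis by simp
qed

text \<open>
  If the limit \<open>l\<close> were not \<open>0\<close>, then \<open>|\<gamma>'|\<close> would be dominated by the integrable function
  \<open>|f A w| |\<gamma>'|\<close> near the end, and \<open>\<gamma>\<close> would have a finite limit there.
\<close>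

lemma weighted_poly_vanishes_at_infinite_end:
  assumes e: "e = 0 \<or> e = 1" and lim: "filterlim \<gamma> at_infinity (at e within {0<..<1})"
  shows "((\<lambda>t. poly f (\<gamma> t) * poly A (\<gamma> t) * w (\<gamma> t)) \<longlongrightarrow> 0) (at e within {0<..<1})"
proof -
  obtain l where l: "((\<lambda>t. poly f (\<gamma> t) * poly A (\<gamma> t) * w (\<gamma> t)) \<longlongrightarrow> l) (at e within {0<..<1})"
    using weighted_poly_end_limit_exists[OF e] by auto
  have "l = 0"
  proof (rule ccontr)
    assume "l \<noteq> 0"
    have "\<forall>\<^sub>F t in at e within {0<..<1}. norm l / 2 < norm (poly f (\<gamma> t) * poly A (\<gamma> t) * w (\<gamma> t))"
      using order_tendstoD(1)[OF tendsto_norm[OF l], of "norm l / 2"] \<open>l \<noteq> 0\<close> by simp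
    then obtain p q where pq: "0 \<le> p" "p < q" "q \<le> 1" "e = p \<or> e = q"
      and L: "\<And>t. t \<in> {p<..<q} \<Longrightarrow> norm l / 2 < norm (poly f (\<gamma> t) * poly A (\<gamma> t) * w (\<gamma> t))"
      by (rule eventually_at_end_on_subinterval[OF e]) blast
    have sub: "{p<..<q} \<subseteq> {0<..<1}" using pq by auto
    have "d\<gamma> absolutely_integrable_on {p<..<q}"
    proof (rule absolutely_integrable_dominated_by_weighted_poly[OF pq(1,3)])
      show "continuous_on ({p<..<q} - corners) d\<gamma>"
        using sub by (intro continuous_on_subset[OF continuous_arc_derivative]) auto
      fix t assume t: "t \<in> {p<..<q}"
      have "1 * norm (d\<gamma> t) \<le> (2 / norm l * norm (poly f (\<gamma> t) * poly A (\<gamma> t) * w (\<gamma> t))) * norm (d\<gamma> t)"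
        using L[OF t] \<open>l \<noteq> 0\<close> by (intro mult_right_mono) (auto simp: field_simps)
      then show "norm (d\<gamma> t) \<le> 2 / norm l * norm (integrand (poly (f * A)) t)"
        by (simp add: norm_mult mult_ac)
    qed
    then have int: "d\<gamma> integrable_on {p..q}"
      using integrable_on_open_interval_real set_lebesgue_integral_eq_integral(1) by blast
    have "\<exists>b. (\<gamma> \<longlongrightarrow> b) (at e within {p<..<q})"
      by (rule endpoint_limit_exists[OF pq(2) finite_corners continuous_on_subset[OF continuous_arc sub] int])
         (use pq sub arc_has_derivative in auto)
    moreover have "filterlim \<gamma> at_infinity (at e within {p<..<q})"
      using lim sub filterlim_mono at_le by blast
    moreover have "at e within {p<..<q} \<noteq> bot"
      using pq by (auto simp: trivial_limit_within islimpt_greaterThanLessThan1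
        islimpt_greaterThanLessThan2)
    ultimately show False using not_tendsto_and_filterlim_at_infinity by blast
  qed
  with l show ?thesis by simp
qed

lemma weighted_poly_vanishes_at_end:
  assumes e: "e = 0 \<or> e = 1"
  shows "((\<lambda>t. poly f (\<gamma> t) * poly A (\<gamma> t) * w (\<gamma> t)) \<longlongrightarrow> 0) (at e within {0<..<1})"
proof -
  have "ends_in \<gamma> (at_right 0) (poly_zeros A)" "ends_in \<gamma> (at_left 1) (poly_zeros A)"
    using arc by (auto simp: piecewise_analytic_jordan_arc_def)
  then have "ends_in \<gamma> (at e within {0<..<1}) (poly_zeros A)"
    using e by (auto simp: at_end_within_open_unit_interval)
  then consider a where "poly A a = 0" "(\<gamma> \<longlongrightarrow> a) (at e within {0<..<1})"
    | "filterlim \<gamma> at_infinity (at e within {0<..<1})"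
    by (auto simp: ends_in_def poly_zeros_def)
  then show ?thesis
  proof cases
    case 1
    have "((\<lambda>t. poly f (\<gamma> t)) \<longlongrightarrow> poly f a) (at e within {0<..<1})"
      by (intro tendsto_intros 1)
    from tendsto_mult[OF this weighted_poly_vanishes_at_finite_end[OF e 1(2,1)]]
    show ?thesis by (simp add: mult_ac)
  next
    case 2
    then show ?thesis by (rule weighted_poly_vanishes_at_infinite_end[OF e])
  qed
qed

text \<open>
  The integrand is the derivative of \<open>f A w\<close> along the arc, a function that is continuous across the
  corners and vanishes at the ends. The growth condition carries this vanishing over from polynomials
  to \<open>f\<close>, which will be \<open>P x / (x - z)\<close>.
\<close>

theorem integral_of_weighted_derivative_is_zero:
  assumes f: "\<And>x. x \<in> arc_interior \<gamma> \<Longrightarrow> (f has_field_derivative f' x) (at x)"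
    and bound: "\<And>x. x \<in> arc_interior \<gamma> \<Longrightarrow> norm (f x) \<le> C * norm (poly p x)"
  shows "(integrand (\<lambda>x. poly A x * f' x + poly (pderiv A + B) x * f x) has_integral 0) {0<..<1}"
proof -
  define G where "G = (\<lambda>t. if t \<in> {0<..<1} then f (\<gamma> t) * poly A (\<gamma> t) * w (\<gamma> t) else 0)"
  have inn: "\<gamma> t \<in> arc_interior \<gamma>" if "t \<in> {0<..<1}" for t using that by (auto simp: arc_interior_def)
  have cont: "continuous_on {0<..<1} (\<lambda>t. f (\<gamma> t) * poly A (\<gamma> t) * w (\<gamma> t))"
  proof (intro continuous_intros continuous_arc weight_continuous)
    have "continuous_on (arc_interior \<gamma>) f"
      using f DERIV_isCont by (blast intro: continuous_at_imp_continuous_on)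
    then show "continuous_on {0<..<1} (\<lambda>t. f (\<gamma> t))"
      using continuous_arc by (rule continuous_on_compose2) (auto simp: arc_interior_def)
  qed
  have ends: "(G \<longlongrightarrow> 0) (at e within {0<..<1})" if e: "e = 0 \<or> e = 1" for e
  proof (rule Lim_null_comparison)
    have "((\<lambda>t. \<bar>C\<bar> * norm (poly p (\<gamma> t) * poly A (\<gamma> t) * w (\<gamma> t))) \<longlongrightarrow> \<bar>C\<bar> * norm (0::complex)) (at e within {0<..<1})"
      by (intro tendsto_intros weighted_poly_vanishes_at_end e)
    then show "((\<lambda>t. \<bar>C\<bar> * norm (poly p (\<gamma> t) * poly A (\<gamma> t) * w (\<gamma> t))) \<longlongrightarrow> 0) (at e within {0<..<1})" by simp
    have "norm (G t) \<le> \<bar>C\<bar> * norm (poly p (\<gamma> t) * poly A (\<gamma> t) * w (\<gamma> t))" if "t \<in> {0<..<1}" for t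
    proof -
      have "norm (f (\<gamma> t)) \<le> C * norm (poly p (\<gamma> t))" by (rule bound[OF inn[OF that]])
      also have "\<dots> \<le> \<bar>C\<bar> * norm (poly p (\<gamma> t))" by (intro mult_right_mono) auto
      finally have "norm (f (\<gamma> t)) * norm (poly A (\<gamma> t) * w (\<gamma> t)) \<le> \<bar>C\<bar> * norm (poly p (\<gamma> t)) * norm (poly A (\<gamma> t) * w (\<gamma> t))"
        by (rule mult_right_mono) simp
      then show ?thesis using that by (simp add: G_def norm_mult mult_ac)
    qed
    then show "\<forall>\<^sub>F t in at e within {0<..<1}. norm (G t) \<le> \<bar>C\<bar> * norm (poly p (\<gamma> t) * poly A (\<gamma> t) * w (\<gamma> t))"
      by (auto simp: eventually_at_filter)
  qed
  have contG: "continuous_on {0..1} G"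
  proof (rule continuous_on_IccI)
    show "(G \<longlongrightarrow> G 0) (at_right 0)" "(G \<longlongrightarrow> G 1) (at_left 1)"
      using ends[of 0] ends[of 1] by (simp_all add: at_end_within_open_unit_interval G_def)
    fix t :: real assume t: "0 < t" "t < 1"
    have "continuous_on {0<..<1} G"
      using cont by (rule continuous_on_eq) (auto simp: G_def)
    then have "isCont G t" using t by (simp add: continuous_on_eq_continuous_at)
    then show "(G \<longlongrightarrow> G t) (at t)" by (simp add: isCont_def)
  qed simp
  have "(integrand (\<lambda>x. poly A x * f' x + poly (pderiv A + B) x * f x) has_integral G 1 - G 0) {0..1}"
  proof (rule fundamental_theorem_of_calculus_interior_strong[OF finite_corners _ _ contG])
    fix t assume t: "t \<in> {0<..<1} - corners"
    then have t01: "t \<in> {0<..<1}" by simp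
    show "(G has_vector_derivative integrand (\<lambda>x. poly A x * f' x + poly (pderiv A + B) x * f x) t) (at t)"
      by (rule has_vector_derivative_transform_within_open
          [OF weight_times_fA_has_derivative[OF t f[OF inn[OF t01]]] open_greaterThanLessThan t01])
         (simp add: G_def)
  qed simp
  then show ?thesis by (simp add: G_def has_integral_Icc_iff_Ioo)
qed

end

section \<open>Integration over the support of the weight\<close>

locale semiclassical =
  fixes A B :: "complex poly" and k :: nat and \<Gamma> :: "nat \<Rightarrow> real \<Rightarrow> complex" and w :: "complex \<Rightarrow> complex"
  assumes semiclassical: "semiclassical_weight A B k \<Gamma> w"
begin

lemma lead_coeff_A: "lead_coeff A = 1"
  using semiclassical by (simp add: semiclassical_weight_def)

lemma weighted_arc: "j < k \<Longrightarrow> weighted_arc A B (\<Gamma> j) w"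
  using semiclassical lead_coeff_A unfolding semiclassical_weight_def weighted_arc_def by auto

definition weighted :: "(complex \<Rightarrow> complex) \<Rightarrow> nat \<Rightarrow> real \<Rightarrow> complex" where
  "weighted f j t = f (\<Gamma> j t) * w (\<Gamma> j t) * vector_derivative (\<Gamma> j) (at t)"

definition int_w :: "(complex \<Rightarrow> complex) \<Rightarrow> complex" where
  "int_w f = Delta_integral k \<Gamma> (\<lambda>x. f x * w x)"

definition w_integrable :: "(complex \<Rightarrow> complex) \<Rightarrow> bool" where
  "w_integrable f \<longleftrightarrow> (\<forall>j<k. weighted f j absolutely_integrable_on {0<..<1})"

abbreviation arcs :: "complex set" where
  "arcs \<equiv> \<Union>j<k. arc_interior (\<Gamma> j)"

lemma arcs_subset_Delta: "arcs \<subseteq> Delta k \<Gamma>"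
  unfolding Delta_def arc_trace_def using closure_subset by blast

lemma closed_Delta: "closed (Delta k \<Gamma>)"
  unfolding Delta_def arc_trace_def by (intro closed_UN) auto

lemma int_w_eq: "int_w f = (\<Sum>j<k. integral {0<..<1} (weighted f j))"
  unfolding int_w_def Delta_integral_def contour_integral_integral weighted_def
  by (simp add: integral_open_interval_real)

lemma w_integrableD:
  assumes "w_integrable f" "j < k"
  shows "weighted f j integrable_on {0<..<1}" "(\<lambda>t. norm (weighted f j t)) integrable_on {0<..<1}"
  using assms set_lebesgue_integral_eq_integral(1) absolutely_integrable_on_def
  unfolding w_integrable_def by blast+

lemma w_integrable_add:
  assumes "w_integrable f" "w_integrable g" shows "w_integrable (\<lambda>x. f x + g x)"
proof -
  have "weighted (\<lambda>x. f x + g x) j = (\<lambda>t. weighted f j t + weighted g j t)" for j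
    by (auto simp: weighted_def algebra_simps)
  with assms show ?thesis
    unfolding w_integrable_def by (auto intro!: set_integral_add)
qed

lemma w_integrable_cmult:
  assumes "w_integrable f" shows "w_integrable (\<lambda>x. c * f x)"
proof -
  have "weighted (\<lambda>x. c * f x) j = (\<lambda>t. c * weighted f j t)" for j
    by (auto simp: weighted_def algebra_simps)
  with assms show ?thesis
    unfolding w_integrable_def by (auto intro!: set_integrable_mult_right)
qed

lemma int_w_add:
  assumes "w_integrable f" "w_integrable g"
  shows "int_w (\<lambda>x. f x + g x) = int_w f + int_w g"
proof -
  have "integral {0<..<1} (weighted (\<lambda>x. f x + g x) j)
      = integral {0<..<1} (weighted f j) + integral {0<..<1} (weighted g j)" if "j < k" for j
  proof -
    have "weighted (\<lambda>x. f x + g x) j = (\<lambda>t. weighted f j t + weighted g j t)"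
      by (auto simp: weighted_def algebra_simps)
    then show ?thesis
      using integral_add[OF w_integrableD(1)[OF assms(1) that] w_integrableD(1)[OF assms(2) that]] by simp
  qed
  then show ?thesis by (simp add: int_w_eq sum.distrib)
qed

lemma int_w_cmult: "int_w (\<lambda>x. c * f x) = c * int_w f"
proof -
  have "weighted (\<lambda>x. c * f x) j = (\<lambda>t. c * weighted f j t)" for j
    by (auto simp: weighted_def algebra_simps)
  then show ?thesis by (simp add: int_w_eq sum_distrib_left)
qed

lemma w_integrable_diff:
  assumes "w_integrable f" "w_integrable g" shows "w_integrable (\<lambda>x. f x - g x)"
  using w_integrable_add[OF assms(1) w_integrable_cmult[OF assms(2), of "-1"]] by simp

lemma int_w_diff:
  assumes "w_integrable f" "w_integrable g"
  shows "int_w (\<lambda>x. f x - g x) = int_w f - int_w g"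
  using int_w_add[OF assms(1) w_integrable_cmult[OF assms(2), of "-1"]]
  int_w_cmult[of "-1" g] by simp

text \<open>
  An arc passes through \<open>z\<close> at most once. The exceptional point is needed for difference quotients
  at \<open>t = z\<close>, where division by zero gives a value other than that of the polynomial quotient.
\<close>

lemma int_w_cong:
  assumes "\<And>x. x \<in> arcs - {z} \<Longrightarrow> f x = g x"
  shows "int_w f = int_w g"
proof -
  have "integral {0<..<1} (weighted f j) = integral {0<..<1} (weighted g j)" if j: "j < k" for j
  proof (rule integral_spike)
    interpret weighted_arc A B "\<Gamma> j" w using j by (rule weighted_arc)
    have "finite {t \<in> {0<..<1}. \<Gamma> j t \<in> {z}}"
      using finite_vimage_IntI[OF _ inj_arc, of "{z}"]
      by (simp add: vimage_def Int_def conj_commute)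
    then show "negligible {t \<in> {0<..<1}. \<Gamma> j t \<in> {z}}" by (rule negligible_finite)
    fix t assume "t \<in> {0<..<1} - {t \<in> {0<..<1}. \<Gamma> j t \<in> {z}}"
    then have "\<Gamma> j t \<in> arcs - {z}" using j unfolding arc_interior_def by blast
    then show "weighted g j t = weighted f j t" using assms by (simp add: weighted_def)
  qed
  then show ?thesis by (simp add: int_w_eq)
qed

lemma w_integrable_poly_growth:
  assumes f: "continuous_on arcs f" and bound: "\<And>x. x \<in> arcs \<Longrightarrow> norm (f x) \<le> C * norm (poly p x)"
  shows "w_integrable f"
  unfolding w_integrable_def
proof (intro allI impI)
  fix j assume j: "j < k"
  interpret weighted_arc A B "\<Gamma> j" w using j by (rule weighted_arc)
  have "continuous_on (arc_interior (\<Gamma> j)) f"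
    by (rule continuous_on_subset[OF f]) (use j in auto)
  from weighted_absolutely_integrable[OF this, of C p]
  show "weighted f j absolutely_integrable_on {0<..<1}"
    using bound j unfolding weighted_def by blast
qed

lemma w_integrable_poly: "w_integrable (poly p)"
  by (rule w_integrable_poly_growth[of _ 1 p]) (auto intro: continuous_intros)

lemma int_w_of_weighted_derivative_is_zero:
  assumes f: "\<And>x. x \<in> arcs \<Longrightarrow> (f has_field_derivative f' x) (at x)"
    and bound: "\<And>x. x \<in> arcs \<Longrightarrow> norm (f x) \<le> C * norm (poly p x)"
  shows "int_w (\<lambda>x. poly A x * f' x + poly (pderiv A + B) x * f x) = 0"
  unfolding int_w_eq
proof (rule sum.neutral, rule ballI)
  fix j assume "j \<in> {..<k}"
  then have j: "j < k" by simp
  interpret weighted_arc A B "\<Gamma> j" w using j by (rule weighted_arc)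
  have "((\<lambda>t. (poly A (\<Gamma> j t) * f' (\<Gamma> j t) + poly (pderiv A + B) (\<Gamma> j t) * f (\<Gamma> j t)) * w (\<Gamma> j t) *
      vector_derivative (\<Gamma> j) (at t)) has_integral 0) {0<..<1}"
    by (rule integral_of_weighted_derivative_is_zero[of f f' C p]) (use f bound j in auto)
  then show "integral {0<..<1} (weighted (\<lambda>x. poly A x * f' x + poly (pderiv A + B) x * f x) j) = 0"
    unfolding weighted_def by (rule integral_unique)
qed

lemma norm_int_w_le:
  assumes "w_integrable f" "w_integrable g"
    and le: "\<And>x. x \<in> arcs \<Longrightarrow> norm (g x) \<le> c * norm (f x)"
  shows "norm (int_w g) \<le> c * (\<Sum>j<k. integral {0<..<1} (\<lambda>t. norm (weighted f j t)))"
  unfolding int_w_eq sum_distrib_left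
proof (rule sum_norm_le)
  fix j assume "j \<in> {..<k}"
  then have j: "j < k" by simp
  have "norm (integral {0<..<1} (weighted g j)) \<le> integral {0<..<1} (\<lambda>t. c * norm (weighted f j t))"
  proof (rule integral_norm_bound_integral)
    fix t :: real assume "t \<in> {0<..<1}"
    then have "norm (g (\<Gamma> j t)) \<le> c * norm (f (\<Gamma> j t))" 
      using j by (intro le) (unfold arc_interior_def, blast)
    then show "norm (weighted g j t) \<le> c * norm (weighted f j t)"
      by (simp add: weighted_def norm_mult mult_right_mono flip: mult.assoc)
  qed (use assms j in \<open>auto intro!: w_integrableD integrable_on_mult_right\<close>)
  then show "norm (integral {0<..<1} (weighted g j)) \<le> c * integral {0<..<1} (\<lambda>t. norm (weighted f j t))"
    by simp
qed

lemma dist_from_Delta: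
  assumes "z \<notin> Delta k \<Gamma>"
  obtains r where "r > 0" "\<And>x. x \<in> arcs \<Longrightarrow> r \<le> norm (x - z)"
proof -
  have "open (- Delta k \<Gamma>)" using closed_Delta by (simp add: open_Compl)
  then obtain r where "r > 0" "ball z r \<subseteq> - Delta k \<Gamma>"
    using assms open_contains_ball by blast
  moreover have "r \<le> norm (x - z)" if "x \<in> arcs" for x
  proof (rule ccontr)
    assume "\<not> r \<le> norm (x - z)"
    then have "x \<in> ball z r" by (simp add: dist_norm norm_minus_commute)
    then show False using \<open>ball z r \<subseteq> - Delta k \<Gamma>\<close> arcs_subset_Delta that by blast
  qed
  ultimately show ?thesis using that by blast
qed

lemma w_integrable_poly_divide:
  assumes "r > 0" "\<And>x. x \<in> arcs \<Longrightarrow> r \<le> norm (q x)" "continuous_on arcs q"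
  shows "w_integrable (\<lambda>x. poly p x / q x)"
proof (rule w_integrable_poly_growth[of _ "1 / r" p])
  fix x assume x: "x \<in> arcs"
  have "norm (poly p x) * r \<le> norm (poly p x) * norm (q x)"
    by (intro mult_left_mono assms(2)[OF x]) auto
  then show "norm (poly p x / q x) \<le> 1 / r * norm (poly p x)"
    using assms(1) less_le_trans[OF assms(1) assms(2)[OF x]] by (simp add: norm_divide field_simps)
next
  show "continuous_on arcs (\<lambda>x. poly p x / q x)"
  proof (intro continuous_intros assms ballI)
    fix x assume "x \<in> arcs"
    then show "q x \<noteq> 0" using assms(1) assms(2)[of x] by auto
  qed
qed

lemma cauchy_transform_eq: "cauchy_transform k \<Gamma> w f z = int_w (\<lambda>x. f x / (x - z))"
  by (simp add: cauchy_transform_def int_w_def)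

lemma w_integrable_over_power:
  assumes "z \<notin> Delta k \<Gamma>"
  shows "w_integrable (\<lambda>x. poly p x / (x - z) ^ n)"
proof -
  obtain r where r: "r > 0" "\<And>x. x \<in> arcs \<Longrightarrow> r \<le> norm (x - z)"
    using dist_from_Delta[OF assms] by blast
  show ?thesis
    by (rule w_integrable_poly_divide[of "r ^ n"])
       (use r in \<open>auto intro!: continuous_intros power_mono simp: norm_power\<close>)
qed

text \<open>
  Differentiation under the integral sign: the difference quotient minus the candidate is \<open>h\<close> times
  an integral that is bounded uniformly for small \<open>h\<close>, since \<open>z\<close> has positive distance from the
  support.
\<close>

lemma cauchy_transform_has_derivative:
  assumes z: "z \<notin> Delta k \<Gamma>"
  shows "(cauchy_transform k \<Gamma> w (poly p) has_field_derivative int_w (\<lambda>x. poly p x / (x - z)\<^sup>2)) (at z)"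
proof -
  obtain r where r: "r > 0" "\<And>x. x \<in> arcs \<Longrightarrow> r \<le> norm (x - z)"
    using dist_from_Delta[OF z] by blast
  define K where "K = (2 / r ^ 3) * (\<Sum>j<k. integral {0<..<1} (\<lambda>t. norm (weighted (poly p) j t)))"
  let ?C = "cauchy_transform k \<Gamma> w (poly p)" and ?D = "int_w (\<lambda>x. poly p x / (x - z)\<^sup>2)"
  have *: "norm ((?C (z + h) - ?C z) / h - ?D) \<le> norm h * K" if h: "h \<noteq> 0" "norm h < r / 2" for h
  proof -
    let ?g = "\<lambda>x. poly p x / ((x - z - h) * (x - z)\<^sup>2)"
    have far: "r / 2 \<le> norm (x - z - h)" if "x \<in> arcs" for x
      using r(2)[OF that] h norm_triangle_ineq2[of "x - z" h] by linarith
    have prod: "r / 2 * r\<^sup>2 \<le> norm ((x - z - h) * (x - z)\<^sup>2)" if "x \<in> arcs" for x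
      unfolding norm_mult norm_power using far[OF that] r that by (intro mult_mono power_mono) auto
    have ig: "w_integrable ?g"
      by (rule w_integrable_poly_divide[of "r / 2 * r\<^sup>2"]) (use prod r in \<open>auto intro!: continuous_intros\<close>)
    have i0: "w_integrable (\<lambda>x. poly p x / (x - (z + h)))"
      by (rule w_integrable_poly_divide[of "r / 2"])
         (use far r in \<open>auto intro!: continuous_intros simp: diff_diff_eq\<close>)
    have i1: "w_integrable (\<lambda>x. poly p x / (x - z))"
      using w_integrable_over_power[OF z, of p 1] by simp
    have i2: "w_integrable (\<lambda>x. h * (poly p x / (x - z)\<^sup>2))"
      by (intro w_integrable_cmult w_integrable_over_power z)
    have "h\<^sup>2 * int_w ?g = int_w (\<lambda>x. h\<^sup>2 * ?g x)" by (rule int_w_cmult[symmetric])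
    also have "\<dots> = int_w (\<lambda>x. poly p x / (x - (z + h)) - poly p x / (x - z) - h * (poly p x / (x - z)\<^sup>2))"
    proof (rule int_w_cong)
      fix x assume "x \<in> arcs - {z}"
      then have "x - z - h \<noteq> 0" "x - z \<noteq> 0" using far[of x] r(1) r(2)[of x] by auto
      moreover have id: "h\<^sup>2 * (a / ((b - h) * b\<^sup>2)) = a / (b - h) - a / b - h * (a / b\<^sup>2)"
        if "b \<noteq> 0" "b - h \<noteq> 0" for a b :: complex
        using that by (simp add: divide_simps) (simp add: algebra_simps power2_eq_square)
      ultimately show "h\<^sup>2 * ?g x = poly p x / (x - (z + h)) - poly p x / (x - z) - h * (poly p x / (x - z)\<^sup>2)"
        unfolding diff_diff_eq[symmetric] by (intro id)
    qed
    also have "\<dots> = ?C (z + h) - ?C z - h * ?D"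
      using int_w_diff[OF w_integrable_diff[OF i0 i1] i2] int_w_diff[OF i0 i1]
      by (simp only: cauchy_transform_eq int_w_cmult)
    finally have eq: "(?C (z + h) - ?C z) / h - ?D = h * int_w ?g"
      using h by (simp add: field_simps power2_eq_square)
    have "norm (int_w ?g) \<le> K"
      unfolding K_def
    proof (rule norm_int_w_le[OF w_integrable_poly ig])
      fix x assume x: "x \<in> arcs"
      have "norm (poly p x) * (r / 2 * r\<^sup>2) \<le> norm (poly p x) * norm ((x - z - h) * (x - z)\<^sup>2)"
        by (intro mult_left_mono prod x) auto
      moreover have "0 < norm ((x - z - h) * (x - z)\<^sup>2)"
        using r(1) by (intro less_le_trans[OF _ prod[OF x]]) simp
      ultimately show "norm (?g x) \<le> 2 / r ^ 3 * norm (poly p x)"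
        using r(1) by (simp add: norm_divide field_simps power2_eq_square power3_eq_cube)
    qed
    then show ?thesis unfolding eq norm_mult by (intro mult_left_mono) auto
  qed
  have "((\<lambda>h. (?C (z + h) - ?C z) / h - ?D) \<longlongrightarrow> 0) (at 0)"
  proof (rule Lim_null_comparison)
    show "\<forall>\<^sub>F h in at 0. norm ((?C (z + h) - ?C z) / h - ?D) \<le> norm h * K"
      unfolding eventually_at using * r(1) by (auto intro!: exI[of _ "r / 2"])
    show "((\<lambda>h::complex. norm h * K) \<longlongrightarrow> 0) (at 0)"
      by (rule tendsto_eq_rhs, (rule tendsto_intros)+) simp
  qed
  then show ?thesis by (simp add: DERIV_def LIM_zero_iff)
qed

end

section \<open>The partner integrand as a polynomial\<close>

text \<open>
  In an element of \<open>complex poly poly\<close> the outer variable stands for \<open>z\<close> and the inner one for \<open>t\<close>: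
  the value at \<open>(z, t)\<close> is \<open>poly (poly Q [:z:]) t\<close>.
\<close>

definition outer_poly :: "complex poly \<Rightarrow> complex poly poly" where
  "outer_poly p = map_poly (\<lambda>c. [:c:]) p"

lemma poly_outer_poly: "poly (outer_poly p) [:z:] = [:poly p z:]"
  unfolding outer_poly_def by (induction p) (auto simp: map_poly_pCons)

lemma divided_difference_poly:
  "\<exists>Q :: complex poly poly. \<forall>z t. (t - z) * poly (poly Q [:z:]) t = poly f t - poly f z"
proof (induction f)
  case 0
  show ?case by (intro exI[of _ 0]) simp
next
  case (pCons a p)
  then obtain Q where Q: "\<And>z t. (t - z) * poly (poly Q [:z:]) t = poly p t - poly p z" by blast
  have "(t - z) * poly (poly (smult [:0, 1:] Q + outer_poly p) [:z:]) t = poly (pCons a p) t - poly (pCons a p) z"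
    for z t
    using Q[of t z] by (simp add: poly_outer_poly) algebra
  then show ?case by blast
qed

lemma second_divided_difference_poly:
  "\<exists>Q :: complex poly poly. \<forall>z t.
     (t - z)\<^sup>2 * poly (poly Q [:z:]) t = poly f z - poly f t + poly (pderiv f) t * (t - z)"
proof (induction f)
  case 0
  show ?case by (intro exI[of _ 0]) simp
next
  case (pCons a p)
  then obtain Q where Q: "\<And>z t. (t - z)\<^sup>2 * poly (poly Q [:z:]) t
      = poly p z - poly p t + poly (pderiv p) t * (t - z)" by blast
  obtain R where R: "\<And>z t. (t - z) * poly (poly R [:z:]) t = poly p t - poly p z"
    using divided_difference_poly[of p] by blast
  have "(t - z)\<^sup>2 * poly (poly (smult [:0, 1:] Q + R) [:z:]) t
      = poly (pCons a p) z - poly (pCons a p) t + poly (pderiv (pCons a p)) t * (t - z)" for z t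
    using Q[of t z] R[of t z] by (simp add: pderiv_pCons) algebra
  then show ?case by blast
qed

text \<open>
  The first two lines are the integrand of the determinant \<open>P (A C' - B C) - A P' C\<close>, where
  \<open>C z = \<Lambda> (P t / (t - z))\<close>. The last line is \<open>P z (A f' + (A' + B) f)\<close> with \<open>f t = P t / (t - z)\<close>;
  its integral vanishes, and it cancels the poles at \<open>t = z\<close>.
\<close>

definition partner_kernel ::
    "complex poly \<Rightarrow> complex poly \<Rightarrow> complex poly \<Rightarrow> complex \<Rightarrow> complex \<Rightarrow> complex" where
  "partner_kernel A B P z t =
     poly P z * (poly A z * (poly P t / (t - z)\<^sup>2) - poly B z * (poly P t / (t - z)))
     - poly A z * poly (pderiv P) z * (poly P t / (t - z))
     + poly P z * (poly A t * (poly (pderiv P) t / (t - z) - poly P t / (t - z)\<^sup>2)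
         + poly (pderiv A + B) t * (poly P t / (t - z)))"

lemma partner_kernel_is_poly:
  "\<exists>Q. \<forall>z t. t \<noteq> z \<longrightarrow> partner_kernel A B P z t = poly (poly Q [:z:]) t"
proof -
  define G where "G = pderiv P * A"
  obtain Q1 where Q1: "\<And>z t. (t - z) * poly (poly Q1 [:z:]) t = poly G t - poly G z"
    using divided_difference_poly[of G] by blast
  obtain Q2 where Q2: "\<And>z t. (t - z) * poly (poly Q2 [:z:]) t = poly P t - poly P z"
    using divided_difference_poly[of P] by blast
  obtain Q3 where Q3: "\<And>z t. (t - z) * poly (poly Q3 [:z:]) t = poly B t - poly B z"
    using divided_difference_poly[of B] by blast
  obtain Q4 where Q4: "\<And>z t. (t - z)\<^sup>2 * poly (poly Q4 [:z:]) t
      = poly A z - poly A t + poly (pderiv A) t * (t - z)"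
    using second_divided_difference_poly[of A] by blast
  define Q where "Q = outer_poly P * Q1 - Q2 * outer_poly G + outer_poly P * [:P:] * (Q3 + Q4)"
  have "partner_kernel A B P z t = poly (poly Q [:z:]) t" if "t \<noteq> z" for z t
  proof -
    have u: "t - z \<noteq> 0" using that by simp
    have e1: "poly (poly Q1 [:z:]) t = (poly (pderiv P) t * poly A t - poly (pderiv P) z * poly A z) / (t - z)"
      using Q1[of t z] u by (simp add: G_def field_simps)
    have e2: "poly (poly Q2 [:z:]) t = (poly P t - poly P z) / (t - z)"
      using Q2[of t z] u by (simp add: field_simps)
    have e3: "poly (poly Q3 [:z:]) t = (poly B t - poly B z) / (t - z)"
      using Q3[of t z] u by (simp add: field_simps)
    have "poly (poly Q4 [:z:]) t = (t - z)\<^sup>2 * poly (poly Q4 [:z:]) t / (t - z)\<^sup>2" using u by simp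
    also have "\<dots> = (poly A z - poly A t + poly (pderiv A) t * (t - z)) / (t - z)\<^sup>2"
      by (simp only: Q4)
    finally have e4: "poly (poly Q4 [:z:]) t = (poly A z - poly A t + poly (pderiv A) t * (t - z)) / (t - z)\<^sup>2" .
    have id: "Pz * (Az * (Pt / u\<^sup>2) - Bz * (Pt / u)) - Az * dPz * (Pt / u)
        + Pz * (At * (dPt / u - Pt / u\<^sup>2) + (dAt + Bt) * (Pt / u))
      = Pz * ((dPt * At - dPz * Az) / u) - (Pt - Pz) / u * (dPz * Az)
        + Pz * Pt * ((Bt - Bz) / u + (Az - At + dAt * u) / u\<^sup>2)"
      if "u \<noteq> 0" for u Pz Az Pt Bz dPz At dPt dAt Bt :: complex
    proof -
      define v where "v = 1 / u"
      have v: "u * v = 1" "\<And>x. x / u = x * v" "\<And>x. x / u\<^sup>2 = x * v\<^sup>2"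
        using that by (auto simp: v_def power_one_over divide_simps)
      show ?thesis unfolding v(2,3) using v(1) by algebra
    qed
    have "poly (poly Q [:z:]) t = poly P z * poly (poly Q1 [:z:]) t
        - poly (poly Q2 [:z:]) t * (poly (pderiv P) z * poly A z)
        + poly P z * poly P t * (poly (poly Q3 [:z:]) t + poly (poly Q4 [:z:]) t)"
      by (simp add: Q_def poly_outer_poly G_def)
    then show ?thesis
      unfolding partner_kernel_def e1 e2 e3 e4 poly_add using id[OF u] by simp
  qed
  then show ?thesis by blast
qed

lemma degree_poly_const_bounded: "\<exists>D. \<forall>z. degree (poly Q [:z::complex:]) \<le> D"
proof (induction Q)
  case 0
  show ?case by simp
next
  case (pCons q Q)
  then obtain D where D: "\<And>z. degree (poly Q [:z:]) \<le> D" by blast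
  have "degree (poly (pCons q Q) [:z:]) \<le> max (degree q) D" for z
    using D[of z] by (auto intro!: degree_add_le order_trans[OF degree_smult_le])
  then show ?case by blast
qed

section \<open>Linear functionals on polynomials\<close>

locale poly_functional =
  fixes L :: "complex poly \<Rightarrow> complex"
  assumes add: "L (p + q) = L p + L q" and smult: "L (smult c p) = c * L p"
begin

lemma zero: "L 0 = 0"
  using smult[of 0 0] by simp

lemma sum: "L (\<Sum>i\<in>I. f i) = (\<Sum>i\<in>I. L (f i))"
  by (induction I rule: infinite_finite_induct) (simp_all add: zero add)

lemma poly_map_poly: "poly (map_poly L Q) z = L (poly Q [:z:])"
  by (induction Q) (simp_all add: zero add smult map_poly_pCons)

text \<open>
  Lagrange interpolation at \<open>0, \<dots>, D\<close>. On polynomials of bounded degree the functional thus becomes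
  a combination of point evaluations, which can be applied to rational functions too, whatever the
  support of the original weight.
\<close>

lemma quadrature:
  "\<exists>c. \<forall>p. degree p \<le> D \<longrightarrow> L p = (\<Sum>i\<le>D. c i * poly p (of_nat i))"
proof -
  define b where "b = (\<lambda>i. \<Prod>j\<in>{..D} - {i}. [:- of_nat j, 1:] :: complex poly)"
  define l where "l = (\<lambda>i. smult (1 / poly (b i) (of_nat i)) (b i))"
  have nz: "poly (b i) (of_nat i) \<noteq> 0" for i
    by (simp add: b_def poly_prod)
  have l: "poly (l i) (of_nat j) = (if i = j then 1 else 0)" if "i \<le> D" "j \<le> D" for i j
    using nz[of i] that by (auto simp: l_def b_def poly_prod)
  have degl: "degree (l i) \<le> D" if "i \<le> D" for i
  proof -
    have "degree (b i) \<le> sum (degree \<circ> (\<lambda>j. [:- of_nat j, 1 :: complex:])) ({..D} - {i})"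
      unfolding b_def by (rule degree_prod_sum_le) auto
    also have "\<dots> = D" using that by simp
    finally show ?thesis by (simp add: l_def)
  qed
  have "L p = (\<Sum>i\<le>D. L (l i) * poly p (of_nat i))" if p: "degree p \<le> D" for p
  proof -
    have "p = (\<Sum>i\<le>D. smult (poly p (of_nat i)) (l i))"
    proof (rule poly_eqI_degree[of "of_nat ` {..D}"])
      fix x :: complex assume "x \<in> of_nat ` {..D}"
      then obtain j where j: "j \<le> D" "x = of_nat j" by auto
      have "poly (\<Sum>i\<le>D. smult (poly p (of_nat i)) (l i)) x
          = (\<Sum>i\<le>D. if i = j then poly p (of_nat i) else 0)"
        unfolding poly_sum by (rule sum.cong) (auto simp: j l)
      then show "poly p x = poly (\<Sum>i\<le>D. smult (poly p (of_nat i)) (l i)) x"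
        using j by simp
    next
      have c: "card (of_nat ` {..D} :: complex set) = Suc D"
        by (subst card_image) (auto simp: inj_on_def)
      show "degree p < card (of_nat ` {..D} :: complex set)" using p c by simp
      have "degree (\<Sum>i\<le>D. smult (poly p (of_nat i)) (l i)) \<le> D"
        by (intro degree_sum_le order_trans[OF degree_smult_le] degl) auto
      then show "degree (\<Sum>i\<le>D. smult (poly p (of_nat i)) (l i)) < card (of_nat ` {..D} :: complex set)"
        using c by simp
    qed
    then have "L p = L (\<Sum>i\<le>D. smult (poly p (of_nat i)) (l i))" by simp
    then show ?thesis by (simp add: sum smult mult.commute)
  qed
  then show ?thesis by (intro exI[of _ "\<lambda>i. L (l i)"]) blast
qed

end

section \<open>Limits at infinity with error of order 1/z\<close>

definition tends_O :: "(complex \<Rightarrow> complex) \<Rightarrow> complex \<Rightarrow> bool" where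
  "tends_O h c \<longleftrightarrow> (\<lambda>z. h z - c) \<in> O[at_infinity](\<lambda>z. 1 / z)"

lemma inverse_tendsto_0_at_infinity: "((\<lambda>z::complex. 1 / z) \<longlongrightarrow> 0) at_infinity"
  using tendsto_inverse_0[where 'a = complex] unfolding inverse_eq_divide .

lemma tends_O_const: "tends_O (\<lambda>z. c) c"
  by (simp add: tends_O_def)

lemma tends_O_add: "tends_O h c \<Longrightarrow> tends_O k d \<Longrightarrow> tends_O (\<lambda>z. h z + k z) (c + d)"
  unfolding tends_O_def using sum_in_bigo(1)[of "\<lambda>z. h z - c" at_infinity _ "\<lambda>z. k z - d"]
  by (simp add: algebra_simps)

lemma tends_O_cmult: "tends_O h c \<Longrightarrow> tends_O (\<lambda>z. a * h z) (a * c)"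
  unfolding tends_O_def using landau_o.big.mult[of "\<lambda>z. a" at_infinity "\<lambda>z. 1" "\<lambda>z. h z - c"]
  by (simp add: algebra_simps)

lemma tends_O_diff: "tends_O h c \<Longrightarrow> tends_O k d \<Longrightarrow> tends_O (\<lambda>z. h z - k z) (c - d)"
  using tends_O_add[of h c "\<lambda>z. -1 * k z" "-1 * d"] tends_O_cmult[of k d "-1"] by simp

lemma tends_O_sum: "(\<And>i. i \<in> I \<Longrightarrow> tends_O (h i) (c i)) \<Longrightarrow> tends_O (\<lambda>z. \<Sum>i\<in>I. h i z) (\<Sum>i\<in>I. c i)"
  by (induction I rule: infinite_finite_induct) (auto intro!: tends_O_const tends_O_add)

lemma tends_O_mult:
  assumes "tends_O h c" "tends_O k d" shows "tends_O (\<lambda>z. h z * k z) (c * d)"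
proof -
  have 1: "(\<lambda>z::complex. 1 / z) \<in> O[at_infinity](\<lambda>z. 1)"
    using inverse_tendsto_0_at_infinity by (intro bigoI_tendsto[of _ _ 0]) auto
  have "(\<lambda>z. h z - c) \<in> O[at_infinity](\<lambda>z. 1)"
    using assms(1) 1 unfolding tends_O_def by (rule landau_o.big_trans)
  from landau_o.big.mult[OF this] assms(2)
  have "(\<lambda>z. (h z - c) * (k z - d)) \<in> O[at_infinity](\<lambda>z. 1 * (1 / z))" unfolding tends_O_def by blast
  then have "tends_O (\<lambda>z. (h z - c) * (k z - d)) 0" by (simp add: tends_O_def)
  from tends_O_add[OF this tends_O_add[OF tends_O_cmult[OF assms(2), of c] tends_O_cmult[OF assms(1), of d]]]
  have "tends_O (\<lambda>z. h z * k z + c * d) (c * d + c * d)"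
    by (simp add: algebra_simps)
  from tends_O_diff[OF this tends_O_const[of "c * d"]] show ?thesis by simp
qed

lemma tends_O_power: "tends_O h c \<Longrightarrow> tends_O (\<lambda>z. h z ^ n) (c ^ n)"
  by (induction n) (auto intro: tends_O_const tends_O_mult)

lemma tends_O_cong: "tends_O h c \<Longrightarrow> (\<forall>\<^sub>F z in at_infinity. h z = k z) \<Longrightarrow> tends_O k c"
  unfolding tends_O_def
  by (subst (asm) landau_o.big.in_cong[of _ "\<lambda>z. k z - c"]) (auto elim: eventually_mono)

lemma tends_O_imp_tendsto:
  assumes "tends_O h c" shows "(h \<longlongrightarrow> c) at_infinity"
proof -
  have "((\<lambda>z. h z - c) \<longlongrightarrow> 0) at_infinity"
  proof -
    obtain K where K: "\<forall>\<^sub>F z in at_infinity. norm (h z - c) \<le> K * norm (1 / z)"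
      using assms unfolding tends_O_def by (elim landau_o.bigE)
    have "((\<lambda>z::complex. K * norm (1 / z)) \<longlongrightarrow> K * norm (0::complex)) at_infinity"
      by (intro tendsto_intros inverse_tendsto_0_at_infinity)
    then have "((\<lambda>z::complex. K * norm (1 / z)) \<longlongrightarrow> 0) at_infinity" by simp
    with K show ?thesis by (rule Lim_null_comparison)
  qed
  then show ?thesis by (simp add: LIM_zero_iff)
qed

lemma tends_O_inverse: "tends_O (\<lambda>z. 1 / z) 0"
  by (simp add: tends_O_def)

lemma eventually_at_infinity_not_eq: "\<forall>\<^sub>F z in at_infinity. z \<noteq> (a::complex)"
  unfolding eventually_at_infinity by (intro exI[of _ "norm a + 1"]) auto

lemma tends_O_inverse_shift: "tends_O (\<lambda>z. 1 / (x - z)) 0"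
  unfolding tends_O_def
proof (rule bigoI[of _ 2])
  have "norm (1 / (x - z) - 0) \<le> 2 * norm (1 / z)" if "norm z \<ge> 2 * norm x + 1" for z
  proof -
    have "norm z \<le> 2 * norm (x - z)"
      using norm_triangle_ineq2[of z x] that by (simp add: norm_minus_commute)
    moreover have "norm z > 0" using that norm_ge_zero[of x] by linarith
    moreover from calculation have "norm (x - z) > 0" by linarith
    ultimately show ?thesis
      by (simp add: norm_divide field_simps)
  qed
  then show "\<forall>\<^sub>F z in at_infinity. norm (1 / (x - z) - 0) \<le> 2 * norm (1 / z)"
    unfolding eventually_at_infinity by blast
qed

lemma tends_O_shift_ratio: "tends_O (\<lambda>z. z / (x - z)) (-1)"
proof -
  have "tends_O (\<lambda>z. x * (1 / (x - z)) - 1) (x * 0 - 1)"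
    by (intro tends_O_diff tends_O_cmult tends_O_inverse_shift tends_O_const)
  then have "tends_O (\<lambda>z. x * (1 / (x - z)) - 1) (-1)" by simp
  then show ?thesis
    by (rule tends_O_cong) (rule eventually_mono[OF eventually_at_infinity_not_eq[of x]], simp add: field_simps)
qed

lemma tends_O_poly:
  assumes "degree p \<le> d" shows "tends_O (\<lambda>z. poly p z / z ^ d) (coeff p d)"
proof -
  have "tends_O (\<lambda>z. \<Sum>i\<le>d. coeff p i * (1 / z) ^ (d - i)) (\<Sum>i\<le>d. coeff p i * 0 ^ (d - i))"
    by (intro tends_O_sum tends_O_cmult tends_O_power tends_O_inverse)
  moreover have "(\<Sum>i\<le>d. coeff p i * 0 ^ (d - i)) = (\<Sum>i\<le>d. if i = d then coeff p i else 0)"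
    by (rule sum.cong) auto
  ultimately have "tends_O (\<lambda>z. \<Sum>i\<le>d. coeff p i * (1 / z) ^ (d - i)) (coeff p d)" by simp
  then show ?thesis
  proof (rule tends_O_cong)
    have "(\<Sum>i\<le>d. coeff p i * (1 / z) ^ (d - i)) = poly p z / z ^ d" if "z \<noteq> 0" for z
    proof -
      have "poly p z = (\<Sum>i\<le>d. coeff p i * z ^ i)"
        unfolding poly_altdef using assms
        by (intro sum.mono_neutral_left) (auto simp: coeff_eq_0)
      moreover have "z ^ i / z ^ d = (1 / z) ^ (d - i)" if "i \<le> d" for i
        using that \<open>z \<noteq> 0\<close> by (simp add: power_diff power_one_over divide_simps)
      ultimately show ?thesis by (simp add: sum_divide_distrib flip: times_divide_eq_right)
    qed
    then show "\<forall>\<^sub>F z in at_infinity. (\<Sum>i\<le>d. coeff p i * (1 / z) ^ (d - i)) = poly p z / z ^ d"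
      by (rule eventually_mono[OF eventually_at_infinity_not_eq[of 0]])
  qed
qed

section \<open>Growth of the partner at infinity\<close>

locale pearson_functional = poly_functional L for L :: "complex poly \<Rightarrow> complex" +
  fixes A B :: "complex poly"
  assumes pearson: "L (A * pderiv f + (pderiv A + B) * f) = 0"
begin

text \<open>
  By \<open>quadrature\<close> all polynomials in \<open>t\<close> that occur may be integrated against point masses \<open>c i\<close> at
  \<open>x i\<close>. Let \<open>C\<close> be the Cauchy transform of \<open>P\<close> with respect to these masses, \<open>C'\<close> its derivative and
  \<open>R\<close> the defect in the Pearson relation for \<open>P t / (t - z)\<close>, which need not vanish for point masses.
  Then \<open>S = P (A C' - B C) - A P' C + P R\<close>. Quasi-orthogonality gives \<open>C = -m z^(-n-1) + \<dots>\<close> and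
  \<open>C' = (n + 1) m z^(-n-2) + \<dots>\<close>, and \<open>R\<close> is negligible, so \<open>P A C' - A P' C\<close> contributes
  \<open>(N + n + 1) m\<close> and \<open>- P B C\<close> contributes \<open>\<kappa> m\<close> to the leading coefficients.
\<close>

lemma partner_asymptotics:
  fixes P :: "complex poly" and Q :: "complex poly poly"
  assumes A: "lead_coeff A = 1" and P: "lead_coeff P = 1" "degree P = N" and nN: "n \<le> N"
    and orth: "\<And>j. j < n \<Longrightarrow> L (monom 1 j * P) = 0"
    and Q: "\<And>z t. t \<noteq> z \<Longrightarrow> partner_kernel A B P z t = poly (poly Q [:z:]) t"
  obtains X Y where "tends_O X (of_nat (N + n + 1) * L (monom 1 n * P))"
    and "tends_O Y (lead_coeff B * L (monom 1 n * P))" and "B = 0 \<Longrightarrow> Y = (\<lambda>z. 0)"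
    and "\<forall>\<^sub>F z in at_infinity. L (poly Q [:z:]) =
      z ^ (N - n) * (z powi (int (degree A) - 2) * X z + z powi (int (degree B) - 1) * Y z)"
proof -
  define m where "m = L (monom 1 n * P)"
  define a where "a = degree A"
  define b where "b = degree B"
  \<comment> \<open>The order to which \<open>R\<close> is expanded: \<open>P R\<close> must be negligible against \<open>P A C'\<close> even for
    constant \<open>A\<close>, and \<open>C'\<close> is of order \<open>z^(-n-2)\<close>.\<close>
  define J where "J = n + 2"
  obtain D0 where D0: "\<And>z. degree (poly Q [:z:]) \<le> D0" using degree_poly_const_bounded by metis
  define D where "D = D0 + N + J + a + b"
  obtain c where c: "\<And>p. degree p \<le> D \<Longrightarrow> L p = (\<Sum>i\<le>D. c i * poly p (of_nat i))"
    using quadrature[of D] by blast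
  define x where "x = (\<lambda>i::nat. of_nat i :: complex)"
  define C where "C = (\<lambda>z. \<Sum>i\<le>D. c i * poly P (x i) / (x i - z))"
  define C' where "C' = (\<lambda>z. \<Sum>i\<le>D. c i * poly P (x i) / (x i - z)\<^sup>2)"
  define R where "R = (\<lambda>z. \<Sum>i\<le>D. c i * (poly A (x i) * (poly (pderiv P) (x i) / (x i - z) - poly P (x i) / (x i - z)\<^sup>2)
         + poly (pderiv A + B) (x i) * (poly P (x i) / (x i - z))))"
  define good where "good = (\<lambda>z::complex. z \<noteq> 0 \<and> (\<forall>i\<le>D. z \<noteq> x i))"
  have ev_good: "\<forall>\<^sub>F z in at_infinity. good z"
    unfolding good_def atMost_iff[symmetric] Ball_def[symmetric]
    by (intro eventually_conj eventually_ball_finite ballI eventually_at_infinity_not_eq) auto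
  have goodD: "z \<noteq> 0" "\<And>i. i \<le> D \<Longrightarrow> x i - z \<noteq> 0" if "good z" for z using that by (auto simp: good_def)
  have open_good: "open {z. good z}"
  proof -
    have "{z. good z} = - insert 0 (x ` {..D})" by (auto simp: good_def)
    then show ?thesis by (simp add: open_Compl finite_imp_closed)
  qed

  have moment: "(\<Sum>i\<le>D. c i * (poly P (x i) * x i ^ j)) = L (monom 1 j * P)" if "j \<le> J" for j
  proof -
    have "degree (monom 1 j * P) \<le> D"
      using degree_mult_le[of "monom 1 j" P] that P(2) by (simp add: D_def degree_monom_eq)
    from c[OF this] show ?thesis by (simp add: x_def poly_monom mult_ac)
  qed

  \<comment> \<open>\<open>z\<^sup>n\<close> may be replaced by \<open>x\<^sup>n\<close> under the sum, because \<open>(x\<^sup>n - z\<^sup>n) / (x - z)\<close> has degree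
    less than \<open>n\<close> in \<open>x\<close>, and \<open>P\<close> is orthogonal to polynomials of such degree.\<close>
  have zC: "z ^ n * C z = (\<Sum>i\<le>D. c i * (poly P (x i) * x i ^ n) / (x i - z))" if "good z" for z
  proof -
    have "(\<Sum>i\<le>D. c i * (poly P (x i) * x i ^ n) / (x i - z)) - z ^ n * C z
        = (\<Sum>i\<le>D. c i * poly P (x i) * ((x i ^ n - z ^ n) / (x i - z)))"
      unfolding C_def sum_distrib_left sum_subtractf[symmetric]
      by (rule sum.cong) (auto simp: field_simps diff_divide_distrib)
    also have "\<dots> = (\<Sum>i\<le>D. \<Sum>j<n. z ^ (n - Suc j) * (c i * (poly P (x i) * x i ^ j)))"
    proof (rule sum.cong[OF refl])
      fix i assume "i \<in> {..D}"
      then have "x i - z \<noteq> 0" using goodD[OF that] by simp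
      then have "(x i ^ n - z ^ n) / (x i - z) = (\<Sum>j<n. z ^ (n - Suc j) * x i ^ j)"
        by (simp add: power_diff_sumr2)
      then show "c i * poly P (x i) * ((x i ^ n - z ^ n) / (x i - z))
          = (\<Sum>j<n. z ^ (n - Suc j) * (c i * (poly P (x i) * x i ^ j)))"
        by (simp add: sum_distrib_left mult_ac)
    qed
    also have "\<dots> = (\<Sum>j<n. z ^ (n - Suc j) * (\<Sum>i\<le>D. c i * (poly P (x i) * x i ^ j)))"
      by (subst sum.swap) (simp add: sum_distrib_left)
    also have "\<dots> = 0"
      using orth by (intro sum.neutral) (auto simp: moment J_def)
    finally show ?thesis by simp
  qed

  have asC: "tends_O (\<lambda>z. z ^ (n + 1) * C z) (- m)"
  proof -
    have "tends_O (\<lambda>z. \<Sum>i\<le>D. c i * (poly P (x i) * x i ^ n) * (z / (x i - z)))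
        (\<Sum>i\<le>D. c i * (poly P (x i) * x i ^ n) * (-1))"
      by (intro tends_O_sum tends_O_cmult tends_O_shift_ratio)
    also have "(\<Sum>i\<le>D. c i * (poly P (x i) * x i ^ n) * (-1)) = - m"
      using moment[of n] by (simp add: m_def J_def sum_negf)
    finally show ?thesis
    proof (rule tends_O_cong)
      show "\<forall>\<^sub>F z in at_infinity. (\<Sum>i\<le>D. c i * (poly P (x i) * x i ^ n) * (z / (x i - z))) = z ^ (n + 1) * C z"
        using ev_good
      proof eventually_elim
        case (elim z)
        have "z ^ (n + 1) * C z = z * (z ^ n * C z)" by simp
        also have "\<dots> = (\<Sum>i\<le>D. c i * (poly P (x i) * x i ^ n) * (z / (x i - z)))"
          unfolding zC[OF elim] sum_distrib_left by (rule sum.cong) auto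
        finally show ?case by simp
      qed
    qed
  qed

  \<comment> \<open>Obtained by differentiating the identity \<open>zC\<close>, which holds on an open set.\<close>
  have zC': "z ^ (n + 2) * C' z = (\<Sum>i\<le>D. c i * (poly P (x i) * x i ^ n) * (z / (x i - z))\<^sup>2) - of_nat n * (z ^ (n + 1) * C z)"
    if z: "good z" for z
  proof -
    have dC: "(C has_field_derivative C' z) (at z)"
      unfolding C_def C'_def using goodD[OF z]
      by (auto intro!: derivative_eq_intros sum.cong simp: field_simps power2_eq_square)
    have "((\<lambda>z. \<Sum>i\<le>D. c i * (poly P (x i) * x i ^ n) / (x i - z)) has_field_derivative
        (\<Sum>i\<le>D. c i * (poly P (x i) * x i ^ n) / (x i - z)\<^sup>2)) (at z)"
      using goodD[OF z]
      by (auto intro!: derivative_eq_intros sum.cong simp: field_simps power2_eq_square)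
    then have 1: "((\<lambda>z. z ^ n * C z) has_field_derivative
        (\<Sum>i\<le>D. c i * (poly P (x i) * x i ^ n) / (x i - z)\<^sup>2)) (at z)"
      by (rule has_field_derivative_transform_within_open[OF _ open_good]) (use z zC in auto)
    have 2: "((\<lambda>z. z ^ n * C z) has_field_derivative of_nat n * z ^ (n - 1) * C z + C' z * z ^ n) (at z)"
    proof -
      have "((\<lambda>z. z ^ n) has_field_derivative of_nat n * z ^ (n - 1)) (at z)"
        by (auto intro!: derivative_eq_intros)
      from DERIV_mult[OF this dC] show ?thesis .
    qed
    have "z\<^sup>2 * (of_nat n * z ^ (n - 1) * C z + C' z * z ^ n)
        = z\<^sup>2 * (\<Sum>i\<le>D. c i * (poly P (x i) * x i ^ n) / (x i - z)\<^sup>2)"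
      using DERIV_unique[OF 2 1] by simp
    also have "\<dots> = (\<Sum>i\<le>D. c i * (poly P (x i) * x i ^ n) * (z / (x i - z))\<^sup>2)"
      unfolding sum_distrib_left by (rule sum.cong) (auto simp: power_divide)
    finally show ?thesis
      by (cases n) (simp_all add: algebra_simps power2_eq_square)
  qed

  have asC': "tends_O (\<lambda>z. z ^ (n + 2) * C' z) (of_nat (n + 1) * m)"
  proof -
    have "tends_O (\<lambda>z. (\<Sum>i\<le>D. c i * (poly P (x i) * x i ^ n) * (z / (x i - z))\<^sup>2) - of_nat n * (z ^ (n + 1) * C z))
        ((\<Sum>i\<le>D. c i * (poly P (x i) * x i ^ n) * (-1)\<^sup>2) - of_nat n * (- m))"
      by (intro tends_O_diff tends_O_sum tends_O_cmult tends_O_power tends_O_shift_ratio asC)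
    also have "(\<Sum>i\<le>D. c i * (poly P (x i) * x i ^ n) * (-1)\<^sup>2) - of_nat n * (- m) = of_nat (n + 1) * m"
      using moment[of n] by (simp add: m_def J_def algebra_simps)
    finally show ?thesis
      by (rule tends_O_cong) (rule eventually_mono[OF ev_good], simp only: zC')
  qed

  \<comment> \<open>\<open>z\<^sup>J P t / (t - z) = F t + V t / (t - z)\<close> with a polynomial \<open>F\<close> in \<open>t\<close>. The Pearson relation is
    exact for \<open>F\<close>, so \<open>z\<^sup>J R\<close> only receives the contribution of \<open>V t / (t - z)\<close>, which is \<open>O(1/z)\<close>.\<close>
  define V where "V = P * monom 1 J"
  define G where "G = A * pderiv V + (pderiv A + B) * V"
  have zR: "z ^ J * R z = (\<Sum>i\<le>D. c i * (poly G (x i) * (1 / (x i - z)) - poly (A * V) (x i) * (1 / (x i - z))\<^sup>2))"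
    if z: "good z" for z
  proof -
    have "poly (smult (z ^ J) P - V) z = 0" by (simp add: V_def poly_monom)
    then obtain F where F: "smult (z ^ J) P - V = [:-z, 1:] * F"
      unfolding poly_eq_0_iff_dvd dvd_def by blast
    define H where "H = A * pderiv F + (pderiv A + B) * F"
    have F': "smult (z ^ J) (pderiv P) - pderiv V = F + [:-z, 1:] * pderiv F"
      using arg_cong[OF F, of pderiv] by (simp add: pderiv_diff pderiv_smult pderiv_mult pderiv_pCons)
    have degV: "degree V \<le> N + J"
      unfolding V_def using degree_mult_le[of P "monom 1 J"] P(2) by (simp add: degree_monom_eq)
    have degF: "degree F \<le> N + J"
    proof (cases "F = 0")
      case False
      have "degree ([:-z, 1:] * F) = degree F + 1" using False by (subst degree_mult_eq) auto
      moreover have "degree (smult (z ^ J) P - V) \<le> N + J"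
        using degV P(2) by (intro degree_diff_le order_trans[OF degree_smult_le]) auto
      ultimately show ?thesis using F by simp
    qed simp
    have "degree H \<le> D"
      unfolding H_def
    proof (intro degree_add_le)
      show "degree (A * pderiv F) \<le> D"
        using degree_mult_le[of A "pderiv F"] degF by (simp add: D_def a_def degree_pderiv)
      have "degree (pderiv A + B) \<le> a + b"
        by (rule degree_add_le) (auto simp: a_def b_def degree_pderiv)
      then show "degree ((pderiv A + B) * F) \<le> D"
        using degree_mult_le[of "pderiv A + B" F] degF by (simp add: D_def)
    qed
    from c[OF this] have H0: "(\<Sum>i\<le>D. c i * poly H (x i)) = 0"
      using pearson[of F] by (simp add: H_def x_def)
    have pt: "z ^ J * (poly A t * (poly (pderiv P) t / (t - z) - poly P t / (t - z)\<^sup>2)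
         + poly (pderiv A + B) t * (poly P t / (t - z)))
       = poly H t + (poly G t * (1 / (t - z)) - poly (A * V) t * (1 / (t - z))\<^sup>2)" if "t - z \<noteq> 0" for t
    proof -
      define v where "v = 1 / (t - z)"
      have v: "(t - z) * v = 1" "\<And>x. x / (t - z) = x * v" "\<And>x. x / (t - z)\<^sup>2 = x * v\<^sup>2"
        using that by (auto simp: v_def power_one_over divide_simps)
      have 1: "z ^ J * poly P t - poly V t = (t - z) * poly F t"
        using arg_cong[OF F, of "\<lambda>p. poly p t"] by (simp add: algebra_simps)
      have 2: "z ^ J * poly (pderiv P) t - poly (pderiv V) t = poly F t + (t - z) * poly (pderiv F) t"
        using arg_cong[OF F', of "\<lambda>p. poly p t"] by (simp add: algebra_simps)
      have id: "zJ * (At * (dPt * v - Pt * v\<^sup>2) + AB * (Pt * v))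
         = (At * dFt + AB * Ft) + ((At * dVt + AB * Vt) * v - At * Vt * v\<^sup>2)"
        if "u * v = 1" "zJ * Pt - Vt = u * Ft" "zJ * dPt - dVt = Ft + u * dFt"
        for zJ At dPt v Pt AB dFt Ft dVt Vt u :: complex
        using that by algebra
      show ?thesis
        unfolding v(2,3) H_def G_def poly_add[of "A * pderiv F"] poly_add[of "A * pderiv V"] poly_mult mult_1
        by (rule id[OF v(1) 1 2])
    qed
    have "z ^ J * R z = (\<Sum>i\<le>D. c i * (poly H (x i)
        + (poly G (x i) * (1 / (x i - z)) - poly (A * V) (x i) * (1 / (x i - z))\<^sup>2)))"
      unfolding R_def sum_distrib_left
    proof (rule sum.cong[OF refl])
      fix i assume "i \<in> {..D}"
      then have "x i - z \<noteq> 0" using goodD[OF z] by simp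
      from pt[OF this] show "z ^ J * (c i * (poly A (x i) * (poly (pderiv P) (x i) / (x i - z) - poly P (x i) / (x i - z)\<^sup>2)
         + poly (pderiv A + B) (x i) * (poly P (x i) / (x i - z))))
        = c i * (poly H (x i) + (poly G (x i) * (1 / (x i - z)) - poly (A * V) (x i) * (1 / (x i - z))\<^sup>2))"
        by (simp only: mult.left_commute[of "z ^ J"])
    qed
    then show ?thesis using H0 by (simp add: distrib_left sum.distrib)
  qed
  have asR: "tends_O (\<lambda>z. z ^ J * R z) 0"
  proof -
    have "tends_O (\<lambda>z. \<Sum>i\<le>D. c i * (poly G (x i) * (1 / (x i - z)) - poly (A * V) (x i) * (1 / (x i - z))\<^sup>2))
       (\<Sum>i\<le>D. c i * (poly G (x i) * 0 - poly (A * V) (x i) * 0\<^sup>2))"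
      by (intro tends_O_sum tends_O_cmult tends_O_diff tends_O_power tends_O_inverse_shift)
    then have "tends_O (\<lambda>z. \<Sum>i\<le>D. c i * (poly G (x i) * (1 / (x i - z)) - poly (A * V) (x i) * (1 / (x i - z))\<^sup>2)) 0"
      by simp
    then show ?thesis
      by (rule tends_O_cong) (rule eventually_mono[OF ev_good], simp only: zR)
  qed

  have S: "L (poly Q [:z:]) = poly P z * (poly A z * C' z - poly B z * C z)
      - poly A z * poly (pderiv P) z * C z + poly P z * R z" if z: "good z" for z
  proof -
    have "L (poly Q [:z:]) = (\<Sum>i\<le>D. c i * poly (poly Q [:z:]) (x i))"
      unfolding x_def by (rule c) (use D0[of z] in \<open>simp add: D_def\<close>)
    also have "\<dots> = (\<Sum>i\<le>D. c i * partner_kernel A B P z (x i))"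
      using goodD(2)[OF z] by (intro sum.cong refl arg_cong2[of _ _ _ _ "(*)"] Q[symmetric]) auto
    also have "\<dots> = poly P z * (poly A z * C' z - poly B z * C z)
      - poly A z * poly (pderiv P) z * C z + poly P z * R z"
      unfolding C_def C'_def R_def partner_kernel_def sum_distrib_left sum_subtractf[symmetric] sum.distrib[symmetric]
      by (rule sum.cong) (simp_all add: algebra_simps)
    finally show ?thesis .
  qed

  \<comment> \<open>All powers of \<open>z\<close> are distributed so that every factor has a limit at infinity; the
    numerator \<open>z P'\<close> is used in place of \<open>P'\<close> because \<open>N - 1\<close> is not available for \<open>N = 0\<close>.\<close>
  define X where "X = (\<lambda>z. (poly P z / z ^ N) * (poly A z / z ^ a) * (z ^ (n + 2) * C' z)
      - (poly A z / z ^ a) * (poly (pCons 0 (pderiv P)) z / z ^ N) * (z ^ (n + 1) * C z)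
      + (poly P z / z ^ N) * (1 / z) ^ a * (z ^ J * R z))"
  define Y where "Y = (\<lambda>z. -1 * ((poly P z / z ^ N) * (poly B z / z ^ b) * (z ^ (n + 1) * C z)))"
  have degP': "degree (pCons 0 (pderiv P)) \<le> N"
    using P(2) by (cases "N = 0") (auto simp: degree_pCons_eq_if degree_pderiv pderiv_eq_0_iff)
  have cP: "coeff P N = 1" "coeff A a = 1" using P A by (auto simp: a_def)
  have cP': "coeff (pCons 0 (pderiv P)) N = of_nat N"
    using cP(1) by (cases N) (auto simp: coeff_pderiv)
  have "tends_O X (coeff P N * coeff A a * (of_nat (n + 1) * m)
      - coeff A a * coeff (pCons 0 (pderiv P)) N * (- m) + coeff P N * 0 ^ a * 0)"
    unfolding X_def using P(2)
    by (intro tends_O_add tends_O_diff tends_O_mult tends_O_poly tends_O_power tends_O_inverse asC asC' asR degP')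
       (auto simp: a_def)
  then have X: "tends_O X (of_nat (N + n + 1) * m)"
    unfolding cP cP' by (simp add: algebra_simps)
  have "tends_O Y (-1 * (coeff P N * coeff B b * (- m)))"
    unfolding Y_def using P(2)
    by (intro tends_O_cmult tends_O_mult tends_O_poly asC) (auto simp: b_def)
  then have Y: "tends_O Y (lead_coeff B * m)"
    unfolding cP by (simp add: b_def)
  have "\<forall>\<^sub>F z in at_infinity. L (poly Q [:z:]) =
      z ^ (N - n) * (z powi (int a - 2) * X z + z powi (int b - 1) * Y z)"
    using ev_good
  proof eventually_elim
    case (elim z)
    have z: "z \<noteq> 0" using goodD(1)[OF elim] .
    have pa: "z powi (int a - 2) = z ^ a / z\<^sup>2" using z by (simp add: power_int_diff)
    have pb: "z powi (int b - 1) = z ^ b / z" using z by (simp add: power_int_diff)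
    have pN: "z ^ (N - n) = z ^ N / z ^ n" using z nN by (simp add: power_diff)
    have X: "X z = poly P z * poly A z * C' z * (z ^ n * z\<^sup>2) / (z ^ N * z ^ a)
        - poly A z * poly (pderiv P) z * C z * (z ^ n * z\<^sup>2) / (z ^ N * z ^ a)
        + poly P z * R z * (z ^ n * z\<^sup>2) / (z ^ N * z ^ a)"
      unfolding X_def J_def using z by (simp add: power_add power_one_over power2_eq_square mult_ac)
    have Y: "Y z = - (poly P z * poly B z * C z * (z ^ n * z) / (z ^ N * z ^ b))"
      unfolding Y_def using z by simp
    show ?case
      unfolding S[OF elim] pa pb pN X Y using z by (simp add: field_simps)
  qed
  moreover have "B = 0 \<Longrightarrow> Y = (\<lambda>z. 0)" by (simp add: Y_def)
  ultimately show ?thesis using X Y that[of X Y] unfolding m_def a_def b_def by blast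
qed

end

lemma degree_from_growth:
  fixes S :: "complex poly"
  assumes "((\<lambda>z. poly S z / z ^ d) \<longlongrightarrow> l) at_infinity"
  shows "degree S \<le> d" "coeff S d = l"
proof -
  have ne: "(at_infinity :: complex filter) \<noteq> bot"
    using trivial_limit_at_infinity[where 'a = complex] by simp
  show deg: "degree S \<le> d"
  proof (rule ccontr)
    assume "\<not> degree S \<le> d"
    then have gt: "d < degree S" by simp
    have "((\<lambda>z. (poly S z / z ^ d) * (1 / z) ^ (degree S - d)) \<longlongrightarrow> l * 0 ^ (degree S - d)) at_infinity"
      by (intro tendsto_intros assms inverse_tendsto_0_at_infinity)
    moreover have "\<forall>\<^sub>F z in at_infinity. (poly S z / z ^ d) * (1 / z) ^ (degree S - d) = poly S z / z ^ degree S"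
      using eventually_at_infinity_not_eq[of 0]
    proof eventually_elim
      case (elim z)
      have "z ^ degree S = z ^ d * z ^ (degree S - d)" using gt by (simp flip: power_add)
      then show ?case using elim by (simp add: power_one_over)
    qed
    ultimately have "((\<lambda>z. poly S z / z ^ degree S) \<longlongrightarrow> l * 0 ^ (degree S - d)) at_infinity"
      by (rule Lim_transform_eventually)
    then have "lead_coeff S = l * 0 ^ (degree S - d)"
      using tendsto_unique[OF ne tends_O_imp_tendsto[OF tends_O_poly[OF order_refl]]] by blast
    moreover have "0 ^ (degree S - d) = (0::complex)" using gt by (simp add: power_0_left)
    ultimately have "lead_coeff S = 0" by simp
    then show False using gt by simp
  qed
  show "coeff S d = l"
    using tendsto_unique[OF ne tends_O_imp_tendsto[OF tends_O_poly[OF deg]] assms] .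
qed

section \<open>The polynomials E, U and H\<close>

lemma polynomial_part_at_infinity_unique:
  assumes "(\<lambda>z. f z - poly E z) \<in> O[at_infinity](\<lambda>z. 1 / z)"
  shows "polynomial_part_at_infinity f = E"
  unfolding polynomial_part_at_infinity_def
proof (rule the_equality)
  show "(\<lambda>z. f z - poly E z) \<in> O[at_infinity](\<lambda>z. 1 / z)" by (fact assms)
next
  fix E' assume "(\<lambda>z. f z - poly E' z) \<in> O[at_infinity](\<lambda>z. 1 / z)"
  then have "tends_O (\<lambda>z. (f z - poly E z) - (f z - poly E' z)) (0 - 0)"
    using assms by (intro tends_O_diff) (simp_all add: tends_O_def)
  then have "((\<lambda>z. poly (E' - E) z / z ^ 0) \<longlongrightarrow> 0) at_infinity"
    using tends_O_imp_tendsto by force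
  from degree_from_growth[OF this] have "E' - E = 0"
    by (metis le_zero_eq leading_coeff_0_iff)
  then show "E' = E" by simp
qed

lemma polynomial_part_at_infinity_quotient:
  fixes F P :: "complex poly"
  assumes "P \<noteq> 0"
  shows "polynomial_part_at_infinity (\<lambda>z. poly F z / poly P z) = F div P"
proof (rule polynomial_part_at_infinity_unique)
  let ?N = "degree P" and ?r = "F mod P"
  have ev: "\<forall>\<^sub>F z in at_infinity. poly P z \<noteq> 0"
  proof -
    have "finite {z. poly P z = 0}" using assms by (rule poly_roots_finite)
    then have "\<forall>\<^sub>F z in at_infinity. \<forall>a\<in>{z. poly P z = 0}. z \<noteq> a"
      by (intro eventually_ball_finite ballI eventually_at_infinity_not_eq)
    then show ?thesis by (rule eventually_mono) auto
  qed
  have deg: "?r = 0 \<or> degree ?r < ?N" using degree_mod_less[OF assms] by blast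
  then have "degree ?r \<le> ?N" "coeff ?r ?N = 0" by (auto simp: coeff_eq_0)
  with tends_O_poly[of ?r ?N] have 1: "(\<lambda>z. poly ?r z / z ^ ?N) \<in> O[at_infinity](\<lambda>z. 1 / z)"
    by (simp add: tends_O_def)
  have "((\<lambda>z. poly P z / z ^ ?N) \<longlongrightarrow> lead_coeff P) at_infinity"
    by (intro tends_O_imp_tendsto tends_O_poly) simp
  then have "((\<lambda>z. 1 / (poly P z / z ^ ?N)) \<longlongrightarrow> 1 / lead_coeff P) at_infinity"
    using assms by (intro tendsto_intros) auto
  then have 2: "(\<lambda>z. 1 / (poly P z / z ^ ?N)) \<in> O[at_infinity](\<lambda>z. 1)"
    by (intro bigoI_tendsto[of _ _ "1 / lead_coeff P"]) auto
  from landau_o.big.mult[OF 1 2]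
  have 3: "(\<lambda>z. poly ?r z / z ^ ?N * (1 / (poly P z / z ^ ?N))) \<in> O[at_infinity](\<lambda>z. 1 / z)" by simp
  have "\<forall>\<^sub>F z in at_infinity. poly ?r z / z ^ ?N * (1 / (poly P z / z ^ ?N)) = poly F z / poly P z - poly (F div P) z"
    using ev eventually_at_infinity_not_eq[of 0]
  proof eventually_elim
    case (elim z)
    have "poly F z = poly (F div P) z * poly P z + poly ?r z"
      by (metis div_mult_mod_eq poly_add poly_mult)
    then show ?case using elim by (simp add: field_simps)
  qed
  from landau_o.big.in_cong[OF this] 3
  show "(\<lambda>z. poly F z / poly P z - poly (F div P) z) \<in> O[at_infinity](\<lambda>z. 1 / z)" by simp
qed

lemma E_poly_eq: "P \<noteq> 0 \<Longrightarrow> E_poly A P = (A * pderiv P) div P"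
  using polynomial_part_at_infinity_quotient[of P "A * pderiv P"] by (simp add: E_poly_def)

lemma U_poly_eq: "P \<noteq> 0 \<Longrightarrow> U_poly A P = (A * pderiv P) mod P"
  by (simp add: U_poly_def E_poly_eq minus_div_mult_eq_mod)

text \<open>
  \<open>A P' / P\<close> grows at most like \<open>z^(deg A - 1)\<close>. The alternative \<open>E = 0\<close> covers \<open>N = 0\<close> and constant \<open>A\<close>.
\<close>

lemma degree_E_poly:
  assumes "P \<noteq> 0" shows "E_poly A P = 0 \<or> degree (E_poly A P) + 1 \<le> degree A"
proof (cases "E_poly A P = 0 \<or> degree P = 0")
  case True
  moreover have "E_poly A P = 0" if "degree P = 0"
  proof -
    have "pderiv P = 0" using that by (simp add: pderiv_eq_0_iff)
    then show ?thesis by (simp add: E_poly_eq[OF assms])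
  qed
  ultimately show ?thesis by blast
next
  case False
  have "degree (E_poly A P) + degree P = degree (E_poly A P * P)"
    using False assms by (simp add: degree_mult_eq)
  also have "E_poly A P * P = A * pderiv P - (A * pderiv P) mod P"
    using assms by (simp add: E_poly_eq minus_mod_eq_div_mult)
  also have "degree \<dots> \<le> degree A + (degree P - 1)"
  proof (rule degree_diff_le)
    show "degree (A * pderiv P) \<le> degree A + (degree P - 1)"
      using degree_mult_le[of A "pderiv P"] by (simp add: degree_pderiv)
    show "degree ((A * pderiv P) mod P) \<le> degree A + (degree P - 1)"
      using degree_mod_less[OF assms, of "A * pderiv P"] by auto
  qed
  finally show ?thesis using False by auto
qed

lemma power_int_tendsto_at_infinity:
  assumes "e \<le> 0"
  shows "((\<lambda>z::complex. z powi e) \<longlongrightarrow> (if e = 0 then 1 else 0)) at_infinity"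
proof -
  have "((\<lambda>z::complex. (1 / z) ^ nat (- e)) \<longlongrightarrow> 0 ^ nat (- e)) at_infinity"
    by (intro tendsto_intros inverse_tendsto_0_at_infinity)
  moreover have "z powi e = (1 / z) ^ nat (- e)" for z :: complex
    using assms by (cases "e = 0") (auto simp: power_int_def inverse_eq_divide power_one_over)
  ultimately show ?thesis using assms by (auto simp: power_0_left)
qed

context semiclassical
begin

definition moment :: "complex poly \<Rightarrow> complex" where "moment p = int_w (poly p)"

text \<open>
  Since polynomials are integrable along all arcs, the integral against \<open>w\<close> is a linear functional
  on them, and the vanishing of the boundary terms is its Pearson relation.
\<close>

sublocale pearson_functional moment A B
proof
  fix p q :: "complex poly" and c :: complex
  show "moment (p + q) = moment p + moment q"
    using int_w_add[OF w_integrable_poly w_integrable_poly, of p q] by (simp add: moment_def flip: poly_add)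
  show "moment (smult c p) = c * moment p"
    using int_w_cmult[of c "poly p"] by (simp add: moment_def flip: poly_smult)
  have "poly (A * pderiv p + (pderiv A + B) * p)
      = (\<lambda>x. poly A x * poly (pderiv p) x + poly (pderiv A + B) x * poly p x)" by (rule ext) simp
  then show "moment (A * pderiv p + (pderiv A + B) * p) = 0"
    unfolding moment_def
    using int_w_of_weighted_derivative_is_zero[of "poly p" "poly (pderiv p)" 1 p] by (simp only: poly_DERIV)
qed

lemma electrostatic_partner_eq:
  assumes z: "z \<notin> Delta k \<Gamma>"
    and Q: "\<And>z t. t \<noteq> z \<Longrightarrow> partner_kernel A B P z t = poly (poly Q [:z:]) t"
  shows "electrostatic_partner A B k \<Gamma> w (poly P) z = moment (poly Q [:z:])"
proof -
  define C1 where "C1 = int_w (\<lambda>x. poly P x / (x - z))"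
  define C2 where "C2 = int_w (\<lambda>x. poly P x / (x - z)\<^sup>2)"
  define G where "G = A * pderiv P + (pderiv A + B) * P"
  let ?W = "\<lambda>t. poly A t * (poly (pderiv P) t / (t - z) - poly P t / (t - z)\<^sup>2)
         + poly (pderiv A + B) t * (poly P t / (t - z))"
  obtain r where r: "r > 0" "\<And>x. x \<in> arcs \<Longrightarrow> r \<le> norm (x - z)"
    using dist_from_Delta[OF z] by blast
  have ne: "x \<noteq> z" if "x \<in> arcs" for x using r(1) r(2)[OF that] by auto
  have W0: "int_w ?W = 0"
  proof (rule int_w_of_weighted_derivative_is_zero[of _ _ "1 / r" P])
    fix x assume x: "x \<in> arcs"
    then have "x - z \<noteq> 0" using ne by simp
    moreover have "((\<lambda>t. t - z) has_field_derivative 1) (at x)"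
      by (auto intro!: derivative_eq_intros)
    ultimately show "((\<lambda>t. poly P t / (t - z)) has_field_derivative
        poly (pderiv P) x / (x - z) - poly P x / (x - z)\<^sup>2) (at x)"
      using DERIV_divide[OF poly_DERIV] by (fastforce simp: diff_divide_distrib power2_eq_square)
    have "norm (poly P x) * r \<le> norm (poly P x) * norm (x - z)"
      by (intro mult_left_mono r(2)[OF x]) auto
    then show "norm (poly P x / (x - z)) \<le> 1 / r * norm (poly P x)"
      using r(1) less_le_trans[OF r(1) r(2)[OF x]] by (simp add: norm_divide field_simps)
  qed
  have iW: "w_integrable ?W"
  proof -
    have "?W = (\<lambda>x. poly G x / (x - z) ^ 1 - poly (A * P) x / (x - z) ^ 2)"
      by (auto simp: G_def algebra_simps add_divide_distrib)
    then show ?thesis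
      using w_integrable_diff[OF w_integrable_over_power[OF z] w_integrable_over_power[OF z]] by metis
  qed
  have i1: "w_integrable (\<lambda>x. poly P x / (x - z))" and i2: "w_integrable (\<lambda>x. poly P x / (x - z)\<^sup>2)"
    using w_integrable_over_power[OF z, of P 1] w_integrable_over_power[OF z, of P 2] by simp_all
  have "moment (poly Q [:z:]) = int_w (partner_kernel A B P z)"
    unfolding moment_def by (rule int_w_cong[of z]) (use Q in auto)
  also have "partner_kernel A B P z = (\<lambda>t. poly P z * poly A z * (poly P t / (t - z)\<^sup>2)
      - (poly P z * poly B z + poly A z * poly (pderiv P) z) * (poly P t / (t - z)) + poly P z * ?W t)"
    unfolding partner_kernel_def by (rule ext) algebra
  also have "int_w \<dots> = poly P z * poly A z * C2
      - (poly P z * poly B z + poly A z * poly (pderiv P) z) * C1"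
    unfolding int_w_add[OF w_integrable_diff[OF w_integrable_cmult[OF i2] w_integrable_cmult[OF i1]]
          w_integrable_cmult[OF iW]]
      int_w_diff[OF w_integrable_cmult[OF i2] w_integrable_cmult[OF i1]] int_w_cmult W0 C1_def C2_def
    by simp
  also have "\<dots> = electrostatic_partner A B k \<Gamma> w (poly P) z"
  proof -
    have "deriv (cauchy_transform k \<Gamma> w (poly P)) z = C2"
      unfolding C2_def using cauchy_transform_has_derivative[OF z] by (rule DERIV_imp_deriv)
    moreover have "deriv (poly P) z = poly (pderiv P) z"
      by (rule DERIV_imp_deriv[OF poly_DERIV])
    ultimately show ?thesis
      unfolding electrostatic_partner_def Let_def det_2 vector_2
      by (simp add: cauchy_transform_eq C1_def algebra_simps)
  qed
  finally show ?thesis by simp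
qed

lemma orthogonal_to_low_degree:
  assumes orth: "\<And>j. j < n \<Longrightarrow> moment (monom 1 j * P) = 0" and f: "f = 0 \<or> degree f < n"
  shows "moment (f * P) = 0"
proof (cases "f = 0")
  case False
  have "f * P = (\<Sum>i\<le>degree f. smult (coeff f i) (monom 1 i * P))"
    by (subst poly_as_sum_of_monoms[of f, symmetric])
       (simp add: sum_distrib_right smult_monom flip: mult_smult_left)
  also have "moment \<dots> = (\<Sum>i\<le>degree f. coeff f i * moment (monom 1 i * P))"
    by (simp add: sum smult)
  also have "\<dots> = 0" using orth f False by (intro sum.neutral) auto
  finally show ?thesis .
qed (simp add: zero)

lemma int_w_poly_mult: "int_w (\<lambda>x. poly f x * poly P x) = moment (f * P)"
  by (simp add: moment_def flip: poly_mult)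

lemma sigma_bounds:
  "int (degree A) - 2 \<le> semiclassical_sigma A B" "B \<noteq> 0 \<Longrightarrow> int (degree B) - 1 \<le> semiclassical_sigma A B"
  by (auto simp: semiclassical_sigma_def)

lemma sigma_nonneg: "semiclassical_sigma A B \<ge> 0"
  using semiclassical by (simp add: semiclassical_weight_def)

text \<open>
  Both integrands of \<open>H\<close> are \<open>P\<close> times a polynomial in the variable of integration, of degree at most
  \<open>deg A - 2\<close> and \<open>max (deg E) (deg B) - 1\<close> respectively; both bounds are at most \<open>\<sigma>\<close>.
\<close>

lemma H_fun_vanishes:
  assumes P: "P \<noteq> 0" and orth: "\<And>j. j < n \<Longrightarrow> moment (monom 1 j * P) = 0"
    and n: "int n \<ge> semiclassical_sigma A B + 1"
  shows "H_fun A B k \<Gamma> w P z = 0"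
proof -
  let ?F = "E_poly A P + B"
  obtain Q where "\<And>z t. (t - z)\<^sup>2 * poly (poly Q [:z:]) t = poly A z - poly A t + poly (pderiv A) t * (t - z)"
    using second_divided_difference_poly[of A] by blast
  then obtain q where q: "\<And>t. (t - z)\<^sup>2 * poly q t = poly A z - poly A t + poly (pderiv A) t * (t - z)"
    by blast
  obtain R where "\<And>z t. (t - z) * poly (poly R [:z:]) t = poly ?F t - poly ?F z"
    using divided_difference_poly[of ?F] by blast
  then obtain d where d: "\<And>t. (t - z) * poly d t = poly ?F t - poly ?F z" by blast
  have "[:-z, 1:] ^ 2 * q = [:poly A z:] - A + pderiv A * [:-z, 1:]"
    by (subst poly_eq_poly_eq_iff[symmetric], rule ext) (use q in \<open>simp add: algebra_simps power2_eq_square\<close>)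
  moreover have "degree ([:poly A z:] - A + pderiv A * [:-z, 1:]) \<le> degree A"
  proof (intro degree_add_le degree_diff_le)
    show "degree (pderiv A * [:-z, 1:]) \<le> degree A"
    proof (cases "degree A = 0")
      case True
      then have "pderiv A = 0" by (simp add: pderiv_eq_0_iff)
      then show ?thesis by simp
    next
      case False
      then show ?thesis using degree_mult_le[of "pderiv A" "[:-z, 1:]"] by (simp add: degree_pderiv)
    qed
  qed auto
  ultimately have "degree ([:-z, 1:] ^ 2 * q) \<le> degree A" by (simp only:)
  moreover have "degree ([:-z, 1:] ^ 2 * q) = degree q + 2" if "q \<noteq> 0"
    using that by (subst degree_mult_eq) (auto simp: degree_power_eq)
  ultimately have "q = 0 \<or> degree q + 2 \<le> degree A" by fastforce
  then have dq: "q = 0 \<or> degree q < n" using n sigma_bounds(1) by auto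
  have "[:-z, 1:] * d = ?F - [:poly ?F z:]"
    by (subst poly_eq_poly_eq_iff[symmetric], rule ext) (use d in \<open>simp add: algebra_simps\<close>)
  moreover have "degree (?F - [:poly ?F z:]) \<le> max (degree (E_poly A P)) (degree B)"
    by (intro degree_diff_le degree_add_le) auto
  ultimately have "degree ([:-z, 1:] * d) \<le> max (degree (E_poly A P)) (degree B)" by (simp only:)
  moreover have "degree ([:-z, 1:] * d) = degree d + 1" if "d \<noteq> 0"
    using that by (subst degree_mult_eq) auto
  ultimately have "d = 0 \<or> degree d + 1 \<le> max (degree (E_poly A P)) (degree B)"
    by (cases "d = 0") (auto simp del: mult_pCons_left)
  then consider "d = 0" | "degree d + 1 \<le> degree (E_poly A P)" | "degree d + 1 \<le> degree B"
    by linarith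
  then have dd: "d = 0 \<or> degree d < n"
  proof cases
    case 2
    then have "E_poly A P \<noteq> 0" by auto
    then show ?thesis using 2 degree_E_poly[OF P, of A] n sigma_bounds(1) by auto
  next
    case 3
    then have "B \<noteq> 0" by auto
    then show ?thesis using 3 n sigma_bounds(2) by auto
  qed simp
  have "H_fun A B k \<Gamma> w P z
     = int_w (\<lambda>x. (poly A z - poly A x + poly (pderiv A) x * (x - z)) / (x - z)\<^sup>2 * poly P x)
     + int_w (\<lambda>x. (poly ?F x - poly ?F z) / (x - z) * poly P x)"
    by (simp add: H_fun_def int_w_def)
  also have "\<dots> = int_w (\<lambda>x. poly q x * poly P x) + int_w (\<lambda>x. poly d x * poly P x)"
    unfolding q[symmetric] d[symmetric]
    by (intro arg_cong2[of _ _ _ _ "(+)"] int_w_cong[of z]) simp_all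
  also have "\<dots> = 0"
    using orthogonal_to_low_degree[OF orth dq] orthogonal_to_low_degree[OF orth dd]
    by (simp add: int_w_poly_mult)
  finally show ?thesis .
qed

text \<open>
  The Pearson relation for \<open>x^j P\<close> contains \<open>x^j A P' = x^j U + x^j E P\<close>; all its other terms are
  \<open>P\<close> times polynomials of degree at most \<open>j + \<sigma> + 1\<close>, hence killed by quasi-orthogonality.
\<close>

lemma U_poly_quasi_orthogonal:
  assumes P: "P \<noteq> 0" and orth: "\<And>j. j < n \<Longrightarrow> moment (monom 1 j * P) = 0"
    and j: "int j \<le> int n - semiclassical_sigma A B - 2"
  shows "moment (monom 1 j * U_poly A P) = 0"
proof -
  let ?M = "monom 1 j :: complex poly"
  have low: "moment (f * ?M * P) = 0" if "f = 0 \<or> degree f + j < n" for f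
  proof (rule orthogonal_to_low_degree[OF orth])
    show "f * ?M = 0 \<or> degree (f * ?M) < n"
      using that degree_mult_le[of f ?M] by (auto simp: degree_monom_eq)
  qed
  have 1: "moment (A * pderiv ?M * P) = 0"
  proof (rule orthogonal_to_low_degree[OF orth])
    show "A * pderiv ?M = 0 \<or> degree (A * pderiv ?M) < n"
    proof (cases j)
      case (Suc i)
      have "degree (A * pderiv ?M) \<le> degree A + i"
        using degree_mult_le[of A "pderiv ?M"] by (simp add: degree_pderiv degree_monom_eq Suc)
      then show ?thesis using j sigma_bounds(1) Suc by auto
    qed (simp add: pderiv_monom)
  qed
  have 2: "moment (pderiv A * ?M * P) = 0"
  proof (rule low)
    show "pderiv A = 0 \<or> degree (pderiv A) + j < n"
      using j sigma_bounds(1) by (cases "degree A = 0") (auto simp: degree_pderiv pderiv_eq_0_iff)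
  qed
  have 3: "moment (B * ?M * P) = 0"
    by (rule low) (use j sigma_bounds(2) in \<open>cases "B = 0"; auto\<close>)
  have 4: "moment (E_poly A P * ?M * P) = 0"
    by (rule low) (use j sigma_bounds(1) degree_E_poly[OF P, of A] in auto)
  have split: "A * pderiv (?M * P) + (pderiv A + B) * (?M * P)
      = ?M * U_poly A P + (A * pderiv ?M * P + (pderiv A * ?M * P + (B * ?M * P + E_poly A P * ?M * P)))"
    by (simp add: U_poly_def pderiv_mult algebra_simps)
  show ?thesis
    using pearson[of "?M * P"] unfolding split by (simp add: add 1 2 3 4)
qed

end

section \<open>The electrostatic partner of a quasi-orthogonal polynomial\<close>

theorem corollary4p1:
  fixes A B P :: "complex poly" and k n N :: nat and \<Gamma> :: "nat \<Rightarrow> real \<Rightarrow> complex"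
    and w :: "complex \<Rightarrow> complex" and m :: complex and \<sigma> :: int
  assumes weight: "semiclassical_weight A B k \<Gamma> w"
    and \<sigma>: "\<sigma> = semiclassical_sigma A B"
    and "n \<le> N" and "degree P = N" and "lead_coeff P = 1"
    and orth: "\<And>j. j < n \<Longrightarrow> Delta_integral k \<Gamma> (\<lambda>x. x ^ j * poly P x * w x) = 0"
    and m: "m = Delta_integral k \<Gamma> (\<lambda>x. x ^ n * poly P x * w x)" and "m \<noteq> 0"
  shows "(\<exists>S :: complex poly.
            (\<forall>z. z \<notin> Delta k \<Gamma> \<longrightarrow> poly S z = electrostatic_partner A B k \<Gamma> w (poly P) z) \<and>
            (\<exists>f\<in>O[at_infinity](\<lambda>z. 1 / z). \<exists>g\<in>O[at_infinity](\<lambda>z. 1 / z).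
               \<forall>\<^sub>F z in at_infinity. poly S z = m * z ^ (N - n) *
                 (of_nat (N + n + 1) * z powi (int (degree A) - 2) * (1 + f z)
                  + lead_coeff B * z powi (int (degree B) - 1) * (1 + g z))) \<and>
            int (degree S) \<le> int (N - n) + \<sigma> \<and>
            ((S = 0 \<or> int (degree S) < int (N - n) + \<sigma>) \<longrightarrow>
               degree A = degree B + 1 \<and> lead_coeff B = - of_nat (N + n + 1))) \<and>
         (int n \<ge> \<sigma> + 1 \<longrightarrow> (\<forall>z. H_fun A B k \<Gamma> w P z = 0)) \<and>
         (int n \<ge> \<sigma> + 2 \<longrightarrow> degree (U_poly A P) \<le> N - 1 \<and>
            (\<forall>j. int j \<le> int n - \<sigma> - 2 \<longrightarrow>
               Delta_integral k \<Gamma> (\<lambda>x. x ^ j * poly (U_poly A P) x * w x) = 0))"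
proof -
  interpret semiclassical A B k \<Gamma> w by unfold_locales (fact weight)
  have moment_monom: "Delta_integral k \<Gamma> (\<lambda>x. x ^ j * poly p x * w x) = moment (monom 1 j * p)" for j p
  proof -
    have "poly (monom 1 j * p) = (\<lambda>x. x ^ j * poly p x)" by (rule ext) (simp add: poly_monom)
    then show ?thesis by (simp add: moment_def int_w_def)
  qed
  have P: "P \<noteq> 0" using \<open>lead_coeff P = 1\<close> by auto
  have orth_moment: "moment (monom 1 j * P) = 0" if "j < n" for j using orth[OF that] by (simp add: moment_monom)
  have moment_n: "moment (monom 1 n * P) = m" using m by (simp add: moment_monom)

  obtain Q where Q: "\<And>z t. t \<noteq> z \<Longrightarrow> partner_kernel A B P z t = poly (poly Q [:z:]) t"
    using partner_kernel_is_poly by blast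
  define S where "S = map_poly moment Q"
  have S: "poly S z = moment (poly Q [:z:])" for z by (simp add: S_def poly_map_poly)
  obtain X Y where X: "tends_O X (of_nat (N + n + 1) * m)" and Y: "tends_O Y (lead_coeff B * m)"
    and Y0: "B = 0 \<Longrightarrow> Y = (\<lambda>z. 0)"
    and growth: "\<forall>\<^sub>F z in at_infinity. poly S z =
      z ^ (N - n) * (z powi (int (degree A) - 2) * X z + z powi (int (degree B) - 1) * Y z)"
    using partner_asymptotics[OF lead_coeff_A \<open>lead_coeff P = 1\<close> \<open>degree P = N\<close> \<open>n \<le> N\<close> orth_moment Q]
    unfolding S moment_n by blast

  have "\<forall>z. z \<notin> Delta k \<Gamma> \<longrightarrow> poly S z = electrostatic_partner A B k \<Gamma> w (poly P) z"
    using electrostatic_partner_eq[OF _ Q] by (simp add: S)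
  moreover have "\<exists>f\<in>O[at_infinity](\<lambda>z. 1 / z). \<exists>g\<in>O[at_infinity](\<lambda>z. 1 / z).
      \<forall>\<^sub>F z in at_infinity. poly S z = m * z ^ (N - n) *
        (of_nat (N + n + 1) * z powi (int (degree A) - 2) * (1 + f z)
         + lead_coeff B * z powi (int (degree B) - 1) * (1 + g z))"
  proof -
    let ?c = "of_nat (N + n + 1) * m" and ?d = "lead_coeff B * m"
    define f where "f = (\<lambda>z. 1 / ?c * X z - 1)"
    define g where "g = (\<lambda>z. if B = 0 then 0 else 1 / ?d * Y z - 1)"
    have c: "?c \<noteq> 0" using \<open>m \<noteq> 0\<close> of_nat_neq_0[of "N + n", where 'a = complex] by simp
    have "tends_O f (1 / ?c * ?c - 1)" unfolding f_def by (intro tends_O_diff tends_O_cmult X tends_O_const)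
    then have f: "f \<in> O[at_infinity](\<lambda>z. 1 / z)" using c by (simp add: tends_O_def)
    have g: "g \<in> O[at_infinity](\<lambda>z. 1 / z)"
    proof (cases "B = 0")
      case False
      then have d: "?d \<noteq> 0" using \<open>m \<noteq> 0\<close> by simp
      have "tends_O (\<lambda>z. 1 / ?d * Y z - 1) (1 / ?d * ?d - 1)"
        by (intro tends_O_diff tends_O_cmult Y tends_O_const)
      then show ?thesis using d False by (simp add: tends_O_def g_def)
    qed (simp add: g_def)
    have Xf: "X z = ?c * (1 + f z)" for z using c by (simp add: f_def)
    have Yg: "Y z = ?d * (1 + g z)" for z
      using \<open>m \<noteq> 0\<close> by (cases "B = 0") (simp_all add: g_def Y0)
    have "\<forall>\<^sub>F z in at_infinity. poly S z = m * z ^ (N - n) *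
        (of_nat (N + n + 1) * z powi (int (degree A) - 2) * (1 + f z)
         + lead_coeff B * z powi (int (degree B) - 1) * (1 + g z))"
      using growth by eventually_elim (simp only: Xf Yg, simp add: algebra_simps)
    with f g show ?thesis by blast
  qed
  moreover have "int (degree S) \<le> int (N - n) + \<sigma> \<and>
      ((S = 0 \<or> int (degree S) < int (N - n) + \<sigma>) \<longrightarrow>
         degree A = degree B + 1 \<and> lead_coeff B = - of_nat (N + n + 1))"
  proof -
    \<comment> \<open>After division by \<open>z^(N - n + \<sigma>)\<close> the two terms have the exponents \<open>\<alpha> \<le> 0\<close> and \<open>\<beta> \<le> 0\<close>, at
      least one of which is \<open>0\<close>. The limit is the coefficient of \<open>S\<close> at the maximal degree; it can
      vanish only if both exponents are \<open>0\<close> and the two leading terms cancel.\<close>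
    let ?\<alpha> = "int (degree A) - 2 - \<sigma>" and ?\<beta> = "int (degree B) - 1 - \<sigma>"
    define d where "d = N - n + nat \<sigma>"
    have \<sigma>0: "\<sigma> \<ge> 0" using sigma_nonneg by (simp add: \<sigma>)
    then have d: "int d = int (N - n) + \<sigma>" by (simp add: d_def)
    define l1 where "l1 = (if ?\<alpha> = 0 then 1 else 0) * (of_nat (N + n + 1) * m)"
    define l2 where "l2 = (if B = 0 then 0 else (if ?\<beta> = 0 then 1 else 0) * (lead_coeff B * m))"
    have 1: "((\<lambda>z. z powi ?\<alpha> * X z) \<longlongrightarrow> l1) at_infinity"
      unfolding l1_def using sigma_bounds(1)
      by (intro tendsto_mult power_int_tendsto_at_infinity tends_O_imp_tendsto[OF X]) (simp add: \<sigma>)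
    have 2: "((\<lambda>z. z powi ?\<beta> * Y z) \<longlongrightarrow> l2) at_infinity"
    proof (cases "B = 0")
      case False
      then have "((\<lambda>z. z powi ?\<beta> * Y z) \<longlongrightarrow> (if ?\<beta> = 0 then 1 else 0) * (lead_coeff B * m)) at_infinity"
        using sigma_bounds(2)
        by (intro tendsto_mult power_int_tendsto_at_infinity tends_O_imp_tendsto[OF Y]) (simp add: \<sigma>)
      with False show ?thesis by (simp add: l2_def)
    qed (simp add: l2_def Y0)
    have "((\<lambda>z. poly S z / z ^ d) \<longlongrightarrow> l1 + l2) at_infinity"
    proof (rule Lim_transform_eventually[OF tendsto_add[OF 1 2]])
      show "\<forall>\<^sub>F z in at_infinity. z powi ?\<alpha> * X z + z powi ?\<beta> * Y z = poly S z / z ^ d"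
        using growth eventually_at_infinity_not_eq[of 0]
      proof eventually_elim
        case (elim z)
        have "z powi \<sigma> = z ^ nat \<sigma>" using \<sigma>0 by (simp add: power_int_def)
        then have zd: "z ^ d = z ^ (N - n) * z powi \<sigma>" by (simp add: d_def power_add)
        have "z powi ?\<alpha> = z powi (int (degree A) - 2) / z powi \<sigma>"
          "z powi ?\<beta> = z powi (int (degree B) - 1) / z powi \<sigma>"
          using elim(2) power_int_diff[of z "int (degree A) - 2" \<sigma>] power_int_diff[of z "int (degree B) - 1" \<sigma>]
          by blast+
        then show ?case
          unfolding elim(1) zd using elim(2) by (simp add: add_divide_distrib)
      qed
    qed
    note lim = degree_from_growth[OF this]
    have "degree A = degree B + 1 \<and> lead_coeff B = - of_nat (N + n + 1)"
      if drop: "S = 0 \<or> int (degree S) < int (N - n) + \<sigma>"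
    proof -
      have "coeff S d = 0" using drop d by (auto intro: coeff_eq_0)
      then have sum0: "l1 + l2 = 0" using lim(2) by simp
      have c: "of_nat (N + n + 1) * m \<noteq> 0" using \<open>m \<noteq> 0\<close> of_nat_neq_0[of "N + n", where 'a = complex] by simp
      have "?\<alpha> = 0 \<or> (B \<noteq> 0 \<and> ?\<beta> = 0)" unfolding \<sigma> semiclassical_sigma_def by auto
      moreover have "?\<alpha> = 0 \<longleftrightarrow> (B \<noteq> 0 \<and> ?\<beta> = 0)"
        using sum0 c \<open>m \<noteq> 0\<close> calculation by (auto simp: l1_def l2_def split: if_splits simp del: of_nat_Suc of_nat_add)
      ultimately have eqs: "?\<alpha> = 0" "B \<noteq> 0" "?\<beta> = 0" by blast+
      then have "(of_nat (N + n + 1) + lead_coeff B) * m = 0"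
        using sum0 by (simp add: l1_def l2_def distrib_right)
      then have "lead_coeff B = - of_nat (N + n + 1)"
        using \<open>m \<noteq> 0\<close> by (simp add: eq_neg_iff_add_eq_0 add.commute del: of_nat_Suc of_nat_add)
      then show ?thesis using eqs(1,3) by linarith
    qed
    then show ?thesis using lim(1) d by linarith
  qed
  moreover have "int n \<ge> \<sigma> + 1 \<longrightarrow> (\<forall>z. H_fun A B k \<Gamma> w P z = 0)"
    using H_fun_vanishes[OF P orth_moment] by (simp add: \<sigma>)
  moreover have "degree (U_poly A P) \<le> N - 1"
    using degree_mod_less[OF P, of "A * pderiv P"] \<open>degree P = N\<close> by (auto simp: U_poly_eq[OF P])
  moreover have "\<forall>j. int j \<le> int n - \<sigma> - 2 \<longrightarrow>
      Delta_integral k \<Gamma> (\<lambda>x. x ^ j * poly (U_poly A P) x * w x) = 0"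
    using U_poly_quasi_orthogonal[OF P orth_moment] by (simp add: \<sigma> moment_monom)
  ultimately show ?thesis by blast
qed

end
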